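(* Let $A\in L(\mathbb{C}^n,\mathbb{C}^n)$ with $m(A)>0$, let $n_0=[k_+(A)/m(A)]$, let $h\in\mathcal{H}_A(B^n)$, and let $v=v(z,s,t)$ be the transition mapping generated by $h$. If $$f(z,t)=e^{tA}\Bigl(z+\sum_{k=2}^{\infty}F_k(z^k,t)\Bigr)$$ is a polynomially bounded solution of $$\frac{\partial f}{\partial t}(z,t)=Df(z,t)\,h(z,t)\quad\text{a.e. } t\ge0,\ z\in B^n, \qquad ( * )$$ then for every $s\ge 0$ and $z\in B^n$ $$f(z,s)=\lim_{t\to\infty}e^{tA}\Bigl(v(z,s,t)+\sum_{k=2}^{n_0}F_k\bigl(v(z,s,t)^k,t\bigr)\Bigr),$$ and the limit is locally uniform in $z$.
   Context: $\mathbb{C}^n$ carries the Euclidean inner product and norm, $B^n$ is the open unit ball, $m(A):=\min\{\operatorname{Re}\langle A(z),z\rangle:\|z\|=1\}$, $k_+(A):=\max\{\operatorname{Re}\lambda:\lambda\in\sigma(A)\}$, and $[\cdot]$ is the integer part. $\mathcal{N}_A$ is the set of holomorphic $h:B^n\to\mathbb{C}^n$ with $h(0)=0$, $Dh(0)=A$ and $\operatorname{Re}\langle h(z),z\rangle>0$ for $z\in B^n\setminus\{0\}$. $\mathcal{H}_A(B^n)$ is the set of $h:B^n\times[0,\infty)\to\mathbb{C}^n$ with $h(\cdot,t)\in\mathcal{N}_A$ for all $t\ge0$ and $h(z,\cdot)$ measurable on $[0,\infty)$ for all $z\in B^n$. The transition mapping $v(z,s,t)$ ($z\in B^n$, $0\le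 s\le t$) generated by $h$ is the unique solution of $\frac{\partial v}{\partial t}=-h(v,t)$ a.e. $t\ge s$, $v(z,s,s)=z$ (known to exist, with $v(\cdot,s,t)$ a univalent self-map of $B^n$ fixing $0$, and $v(z,s,\cdot)$ Lipschitz on $[s,\infty)$ locally uniformly in $z$). Solutions $f$ of $( * )$ are holomorphic in $z$, locally absolutely continuous in $t$ locally uniformly with respect to $z$, satisfy $( * )$ for almost every $t\ge0$ and all $z\in B^n$, and are normalized by $f(0,t)=0$, $Df(0,t)=e^{tA}$; $F_k(\cdot,t)$ denotes a homogeneous polynomial mapping of degree $k$, with $F_k(z^k,t)$ its value at $z$. A solution $f$ is polynomially bounded if for every compact $K\subset B^n$ there are a constant $C_K$ and a polynomial $P$ with $\|e^{-tA}f(z,t)\|\le C_KP(t)$ for $z\in K$, $t\ge0$. *)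

theory Defs
  imports "HOL-Analysis.Analysis" "HOL-Computational_Algebra.Polynomial"
begin

text \<open>Linear operators on $\mathbb{C}^n$ are square complex matrices indexed by a finite type.
  Maps defined on the open unit ball \<open>ball 0 1\<close>, or for times \<open>t \<ge> 0\<close>, are
  represented by total functions; their values outside these domains are never constrained.\<close>

definition cinner :: "complex^'n \<Rightarrow> complex^'n \<Rightarrow> complex" where
  "cinner x y = (\<Sum>i\<in>UNIV. x $ i * cnj (y $ i))"

text \<open>The infimum is a minimum, by compactness of the unit sphere.\<close>

definition m_lower :: "complex^'n^'n \<Rightarrow> real" where
  "m_lower A = Inf {Re (cinner (A *v z) z) | z. norm z = 1}"

definition spectrum :: "complex^'n^'n \<Rightarrow> complex set" where
  "spectrum A = {l. \<not> invertible (A - mat l)}"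

definition k_plus :: "complex^'n^'n \<Rightarrow> real" where
  "k_plus A = Max (Re ` spectrum A)"

text \<open>The library multiplication \<open>(*)\<close> on vectors is componentwise, so matrix powers
  are iterates of \<open>(**)\<close>.\<close>

definition mexp :: "complex^'n^'n \<Rightarrow> complex^'n^'n" where
  "mexp M = (\<Sum>k. (1 / fact k) *\<^sub>R (((**) M) ^^ k) (mat 1))"

text \<open>A matrix acts complex-linearly, so this is complex (Frechet) differentiability at
  every point.\<close>

definition holomorphic_map_on :: "(complex^'n \<Rightarrow> complex^'n) \<Rightarrow> (complex^'n) set \<Rightarrow> bool" where
  "holomorphic_map_on g S \<longleftrightarrow>
     (\<forall>z\<in>S. \<exists>M::complex^'n^'n. (g has_derivative (\<lambda>w. M *v w)) (at z))"

definition class_N :: "complex^'n^'n \<Rightarrow> (complex^'n \<Rightarrow> complex^'n) set" where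
  "class_N A = {h. holomorphic_map_on h (ball 0 1) \<and> h 0 = 0 \<and>
      (h has_derivative (\<lambda>w. A *v w)) (at 0) \<and>
      (\<forall>z\<in>ball 0 1 - {0}. Re (cinner (h z) z) > 0)}"

definition class_H :: "complex^'n^'n \<Rightarrow> (complex^'n \<Rightarrow> real \<Rightarrow> complex^'n) set" where
  "class_H A = {h. (\<forall>t\<ge>0. (\<lambda>z. h z t) \<in> class_N A) \<and>
      (\<forall>z\<in>ball 0 1. (\<lambda>t. h z t) \<in> borel_measurable (lebesgue_on {0..}))}"

text \<open>Absolute continuity on \<open>I\<close> of all functions \<open>g z\<close>, \<open>z \<in> K\<close>, with a
  \<open>\<delta>\<close> that does not depend on \<open>z\<close>.\<close>

definition unif_abs_cont_on ::
    "'a set \<Rightarrow> real set \<Rightarrow> ('a \<Rightarrow> real \<Rightarrow> 'b::real_normed_vector) \<Rightarrow> bool" where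
  "unif_abs_cont_on K I g \<longleftrightarrow>
     (\<forall>\<epsilon>>0. \<exists>\<delta>>0. \<forall>(N::nat) a b.
        (\<forall>i<N. a i \<le> b i \<and> {a i..b i} \<subseteq> I) \<and>
        (\<forall>i<N. \<forall>j<N. i \<noteq> j \<longrightarrow> {a i<..<b i} \<inter> {a j<..<b j} = {}) \<and>
        (\<Sum>i<N. b i - a i) < \<delta> \<longrightarrow>
        (\<forall>z\<in>K. (\<Sum>i<N. norm (g z (b i) - g z (a i))) < \<epsilon>))"

text \<open>For each \<open>z\<close> and \<open>s\<close> the trajectory \<open>t \<mapsto> v z s t\<close> is a solution in
  the sense of Caratheodory: locally absolutely continuous on \<open>[s,\<infinity>)\<close> and satisfying the
  equation almost everywhere. This determines \<open>v z s t\<close> for \<open>z\<close> in the ball and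
  \<open>0 \<le> s \<le> t\<close>.\<close>

definition transition_mapping ::
    "(complex^'n \<Rightarrow> real \<Rightarrow> complex^'n) \<Rightarrow> (complex^'n \<Rightarrow> real \<Rightarrow> real \<Rightarrow> complex^'n) \<Rightarrow> bool" where
  "transition_mapping h v \<longleftrightarrow>
     (\<forall>z\<in>ball 0 1. \<forall>s\<ge>0.
        v z s s = z \<and>
        (\<forall>t\<ge>s. v z s t \<in> ball 0 1) \<and>
        (\<forall>T\<ge>s. unif_abs_cont_on {z} {s..T} (\<lambda>w. v w s)) \<and>
        (AE t in lebesgue. t \<ge> s \<longrightarrow>
           ((\<lambda>\<tau>. v z s \<tau>) has_vector_derivative - h (v z s t) t) (at t)))"

text \<open>The exceptional null set of times in the differential equation is independent of \<open>z\<close>.\<close>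

definition loewner_solution ::
    "complex^'n^'n \<Rightarrow> (complex^'n \<Rightarrow> real \<Rightarrow> complex^'n) \<Rightarrow> (complex^'n \<Rightarrow> real \<Rightarrow> complex^'n) \<Rightarrow> bool" where
  "loewner_solution A h f \<longleftrightarrow>
     (\<forall>t\<ge>0. holomorphic_map_on (\<lambda>z. f z t) (ball 0 1)) \<and>
     (\<forall>K T. compact K \<and> K \<subseteq> ball 0 1 \<and> T \<ge> 0 \<longrightarrow> unif_abs_cont_on K {0..T} f) \<and>
     (AE t in lebesgue. t \<ge> 0 \<longrightarrow>
        (\<forall>z\<in>ball 0 1. ((\<lambda>\<tau>. f z \<tau>) has_vector_derivative
            frechet_derivative (\<lambda>w. f w t) (at z) (h z t)) (at t))) \<and>
     (\<forall>t\<ge>0. f 0 t = 0 \<and>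
        ((\<lambda>z. f z t) has_derivative (\<lambda>w. mexp (t *\<^sub>R A) *v w)) (at 0))"

definition polynomially_bounded ::
    "complex^'n^'n \<Rightarrow> (complex^'n \<Rightarrow> real \<Rightarrow> complex^'n) \<Rightarrow> bool" where
  "polynomially_bounded A f \<longleftrightarrow>
     (\<forall>K. compact K \<and> K \<subseteq> ball 0 1 \<longrightarrow>
        (\<exists>(C::real) (P::real poly). \<forall>z\<in>K. \<forall>t\<ge>0.
           norm (mexp ((- t) *\<^sub>R A) *v f z t) \<le> C * poly P t))"

text \<open>The sum is over the multi-indices \<open>\<alpha>\<close> of degree \<open>k\<close>; the coefficients
  \<open>c \<alpha>\<close> are vectors.\<close>

definition homogeneous_poly_map :: "nat \<Rightarrow> (complex^'n \<Rightarrow> complex^'n) \<Rightarrow> bool" where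
  "homogeneous_poly_map k P \<longleftrightarrow>
     (\<exists>c :: ('n \<Rightarrow> nat) \<Rightarrow> complex^'n. \<forall>z.
        P z = (\<Sum>\<alpha> | (\<Sum>j\<in>UNIV. \<alpha> j) = k. (\<Prod>j\<in>UNIV. (z $ j) ^ \<alpha> j) *s c \<alpha>))"

end

theory Submission
  imports Defs "HOL-Complex_Analysis.Complex_Analysis"
    "HOL-Computational_Algebra.Fundamental_Theorem_Algebra"
begin

text \<open>Along the characteristics the solution is constant, \<open>f(v(z,s,t),t) = f(z,s)\<close>, so the error of
  the truncated expansion is \<open>e\<^sup>t\<^sup>A\<close> applied to the tail \<open>\<Sum>\<^sub>k\<^sub>>\<^sub>n\<^sub>0 F\<^sub>k(v\<^sup>k,t)\<close>. By Cauchy's estimates the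
  tail is at most a polynomial in \<open>t\<close> times \<open>\<parallel>v\<parallel>\<close> to the power \<open>n\<^sub>0 + 1\<close>. The Harnack inequality for
  functions with positive real part gives \<open>Re \<langle>h(z),z\<rangle> \<ge> m(A) \<parallel>z\<parallel>\<^sup>2 (1 - \<parallel>z\<parallel>) / (1 + \<parallel>z\<parallel>)\<close> and hence
  \<open>\<parallel>v(z,s,t)\<parallel> = O(exp (- m(A) t))\<close>, whereas \<open>e\<^sup>t\<^sup>A = O(exp (\<kappa> t))\<close> for every \<open>\<kappa> > k\<^sub>+(A)\<close>. Since
  \<open>(n\<^sub>0 + 1) m(A) > k\<^sub>+(A)\<close>, the error decays exponentially.\<close>

section \<open>Absolutely continuous functions\<close>

text \<open>Trajectories and solutions are only absolutely continuous in t and obey their equations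
  almost everywhere. Every comparison therefore rests on one principle: an absolutely continuous
  function whose derivative is at most M off a null set grows at rate at most M. It yields the
  Gronwall estimates and, with M = 0, the constancy of f(v(z,s,t),t). The latter needs a chain rule
  although f is not assumed jointly differentiable; Cauchy's estimates in z, applied to f(.,\<tau>)
  - f(.,t), take the place of joint differentiability. They call for bounds on f uniform in z and t,
  which polynomial boundedness supplies.

  The rate of decay has to be m(A) itself: a rate m(A)(1 - r)/(1 + r), multiplied by n_0 + 1, may
  fall below k_+(A). A small loss in the exponent of e^{tA}, where Jordan blocks add polynomial
  factors, is harmless, because the integer part leaves a strict gap.\<close>

lemma unif_abs_cont_on_dominated:
  fixes g :: "'a \<Rightarrow> real \<Rightarrow> 'b::real_normed_vector" and G :: "'c \<Rightarrow> real \<Rightarrow> 'd::real_normed_vector"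
  assumes g: "unif_abs_cont_on {z} I g"
    and L: "\<And>x y. x \<in> I \<Longrightarrow> y \<in> I \<Longrightarrow> x \<le> y \<Longrightarrow>
      norm (G w y - G w x) \<le> L * norm (g z y - g z x) + L * (y - x)"
    and L0: "L \<ge> 0"
  shows "unif_abs_cont_on {w} I G"
  unfolding unif_abs_cont_on_def
proof (intro allI impI)
  fix e :: real assume "e > 0"
  define e' where "e' = e / (2 * (L + 1))"
  have "e' > 0" using \<open>e > 0\<close> L0 by (simp add: e'_def)
  with g obtain d where "d > 0" and d: "\<forall>(N::nat) a b. (\<forall>i<N. a i \<le> b i \<and> {a i..b i} \<subseteq> I) \<and>
      (\<forall>i<N. \<forall>j<N. i \<noteq> j \<longrightarrow> {a i<..<b i} \<inter> {a j<..<b j} = {}) \<and>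
      (\<Sum>i<N. b i - a i) < d \<longrightarrow> (\<forall>x\<in>{z}. (\<Sum>i<N. norm (g x (b i) - g x (a i))) < e')"
    unfolding unif_abs_cont_on_def by blast
  show "\<exists>\<delta>>0. \<forall>(N::nat) a b.
        (\<forall>i<N. a i \<le> b i \<and> {a i..b i} \<subseteq> I) \<and>
        (\<forall>i<N. \<forall>j<N. i \<noteq> j \<longrightarrow> {a i<..<b i} \<inter> {a j<..<b j} = {}) \<and>
        (\<Sum>i<N. b i - a i) < \<delta> \<longrightarrow>
        (\<forall>z\<in>{w}. (\<Sum>i<N. norm (G z (b i) - G z (a i))) < e)"
  \<comment> \<open>The total length is kept below e' as well, so that the summands L * (y - x)
    contribute at most L * e'.\<close>
  proof (intro exI[of _ "min d e'"] conjI allI impI ballI)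
    show "min d e' > 0" using \<open>d > 0\<close> \<open>e' > 0\<close> by simp
    fix N :: nat and a b :: "nat \<Rightarrow> real" and x
    assume x: "x \<in> {w}" and H: "(\<forall>i<N. a i \<le> b i \<and> {a i..b i} \<subseteq> I) \<and>
        (\<forall>i<N. \<forall>j<N. i \<noteq> j \<longrightarrow> {a i<..<b i} \<inter> {a j<..<b j} = {}) \<and>
        (\<Sum>i<N. b i - a i) < min d e'"
    have "(\<Sum>i<N. norm (G x (b i) - G x (a i))) \<le>
        (\<Sum>i<N. L * norm (g z (b i) - g z (a i)) + L * (b i - a i))"
    proof (rule sum_mono)
      fix i assume "i \<in> {..<N}"
      then have *: "a i \<le> b i" "{a i..b i} \<subseteq> I" using H by auto
      then have "a i \<in> I" "b i \<in> I" by (meson atLeastAtMost_iff order_refl subsetD)+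
      then show "norm (G x (b i) - G x (a i)) \<le> L * norm (g z (b i) - g z (a i)) + L * (b i - a i)"
        using L[of "a i" "b i"] x * by simp
    qed
    also have "\<dots> = L * (\<Sum>i<N. norm (g z (b i) - g z (a i))) + L * (\<Sum>i<N. b i - a i)"
      by (simp add: sum.distrib sum_distrib_left)
    also have "\<dots> \<le> L * e' + L * e'"
      using d[THEN spec[of _ N], THEN spec[of _ a], THEN spec[of _ b]] H L0 by (intro add_mono mult_left_mono) auto
    also have "\<dots> < e' * (2 * (L + 1))"
      using \<open>e' > 0\<close> by (simp add: algebra_simps)
    also have "\<dots> = e" using L0 by (simp add: e'_def)
    finally show "(\<Sum>i<N. norm (G x (b i) - G x (a i))) < e" .
  qed
qed

lemma unif_abs_cont_on_subset:
  "unif_abs_cont_on K I g \<Longrightarrow> K' \<subseteq> K \<Longrightarrow> I' \<subseteq> I \<Longrightarrow> unif_abs_cont_on K' I' g"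
proof -
  assume g: "unif_abs_cont_on K I g" and K: "K' \<subseteq> K" and I: "I' \<subseteq> I"
  show ?thesis
    unfolding unif_abs_cont_on_def
  proof (intro allI impI)
    fix e :: real assume "e > 0"
    with g obtain d where "d > 0" and d: "\<forall>(N::nat) a b. (\<forall>i<N. a i \<le> b i \<and> {a i..b i} \<subseteq> I) \<and>
        (\<forall>i<N. \<forall>j<N. i \<noteq> j \<longrightarrow> {a i<..<b i} \<inter> {a j<..<b j} = {}) \<and>
        (\<Sum>i<N. b i - a i) < d \<longrightarrow> (\<forall>x\<in>K. (\<Sum>i<N. norm (g x (b i) - g x (a i))) < e)"
      unfolding unif_abs_cont_on_def by blast
    show "\<exists>d>0. \<forall>(N::nat) a b. (\<forall>i<N. a i \<le> b i \<and> {a i..b i} \<subseteq> I') \<and>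
        (\<forall>i<N. \<forall>j<N. i \<noteq> j \<longrightarrow> {a i<..<b i} \<inter> {a j<..<b j} = {}) \<and>
        (\<Sum>i<N. b i - a i) < d \<longrightarrow> (\<forall>x\<in>K'. (\<Sum>i<N. norm (g x (b i) - g x (a i))) < e)"
    proof (intro exI[of _ d] conjI allI impI ballI)
      fix N :: nat and a b :: "nat \<Rightarrow> real" and x
      assume H: "(\<forall>i<N. a i \<le> b i \<and> {a i..b i} \<subseteq> I') \<and>
        (\<forall>i<N. \<forall>j<N. i \<noteq> j \<longrightarrow> {a i<..<b i} \<inter> {a j<..<b j} = {}) \<and> (\<Sum>i<N. b i - a i) < d"
        and x: "x \<in> K'"
      have "\<forall>i<N. a i \<le> b i \<and> {a i..b i} \<subseteq> I"
        using conjunct1[OF H] order_trans[OF _ I] by auto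
      then have "(\<forall>i<N. a i \<le> b i \<and> {a i..b i} \<subseteq> I) \<and>
        (\<forall>i<N. \<forall>j<N. i \<noteq> j \<longrightarrow> {a i<..<b i} \<inter> {a j<..<b j} = {}) \<and> (\<Sum>i<N. b i - a i) < d"
        using conjunct2[OF H] by (rule conjI)
      then have "\<forall>x\<in>K. (\<Sum>i<N. norm (g x (b i) - g x (a i))) < e"
        by (rule d[THEN spec, THEN spec, THEN spec, THEN mp])
      then show "(\<Sum>i<N. norm (g x (b i) - g x (a i))) < e" using x K by auto
    qed (fact \<open>d > 0\<close>)
  qed
qed

text \<open>A gauge argument: Henstock--Kurzweil integrability of the indicator of the exceptional set
  makes the total length of the intervals tagged in that set small.\<close>

lemma abs_cont_increment_le:
  fixes g :: "'a \<Rightarrow> real \<Rightarrow> real"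
  assumes ac: "unif_abs_cont_on {z} {a..b} g" and ab: "a \<le> b" and N: "negligible N"
    and deriv: "\<And>x. x \<in> {a..b} - N \<Longrightarrow>
      \<exists>D. (g z has_real_derivative D) (at x within {a..b}) \<and> D \<le> M"
    and M: "M \<ge> 0"
  shows "g z b - g z a \<le> M * (b - a)"
proof (rule field_le_epsilon)
  fix e0 :: real assume "e0 > 0"
  \<comment> \<open>The errors e * (b - a) from tags outside \<open>N\<close> and e from tags in
    \<open>N\<close> add up to e0.\<close>
  define e where "e = e0 / (b - a + 1)"
  have e: "e > 0" using \<open>e0 > 0\<close> ab by (simp add: e_def)
  from ac e obtain d where "d > 0" and d: "\<forall>(n::nat) l r. (\<forall>i<n. l i \<le> r i \<and> {l i..r i} \<subseteq> {a..b}) \<and>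
      (\<forall>i<n. \<forall>j<n. i \<noteq> j \<longrightarrow> {l i<..<r i} \<inter> {l j<..<r j} = {}) \<and>
      (\<Sum>i<n. r i - l i) < d \<longrightarrow> (\<forall>x\<in>{z}. (\<Sum>i<n. norm (g x (r i) - g x (l i))) < e)"
    unfolding unif_abs_cont_on_def by blast
  have "(indicat_real N has_integral 0) {a..b}"
    using N unfolding negligible_def by (metis interval_cbox)
  from this[unfolded has_integral_real, THEN spec, THEN mp, OF \<open>d > 0\<close>]
  obtain G1 where G1: "gauge G1 \<and> (\<forall>p. p tagged_division_of {a..b} \<and> G1 fine p \<longrightarrow>
      norm ((\<Sum>(x,k)\<in>p. measure lborel k *\<^sub>R indicat_real N x) - 0) < d)"
    by (rule exE)
  \<comment> \<open>One-sided slope estimates on either side of a tag outside \<open>N\<close>;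
    added, they bound the increment over any short interval containing x, wherever x lies in
    it.\<close>
  have "\<exists>c>0. \<forall>y\<in>{a..b}. \<bar>y - x\<bar> < c \<longrightarrow> (x \<le> y \<longrightarrow> g z y - g z x \<le> (M + e) * (y - x)) \<and>
        (y \<le> x \<longrightarrow> g z x - g z y \<le> (M + e) * (x - y))"
    if x: "x \<in> {a..b} - N" for x
  proof -
    obtain D where D: "(g z has_real_derivative D) (at x within {a..b})" "D \<le> M"
      using deriv[OF x] by blast
    then obtain c where "c > 0" and
      c: "\<And>y. y\<in>{a..b} \<Longrightarrow> norm (y - x) < c \<Longrightarrow> norm (g z y - g z x - D * (y - x)) \<le> e * norm (y - x)"
      using e unfolding has_field_derivative_def has_derivative_within_alt by metis
    show ?thesis
    proof (intro exI[of _ c] conjI ballI impI)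
      fix y assume y: "y \<in> {a..b}" "\<bar>y - x\<bar> < c"
      have *: "\<bar>g z y - g z x - D * (y - x)\<bar> \<le> e * \<bar>y - x\<bar>" using c[OF y(1)] y(2) by simp
      { assume "x \<le> y"
        then have "D * (y - x) \<le> M * (y - x)" using D(2) by (intro mult_right_mono) auto
        then show "g z y - g z x \<le> (M + e) * (y - x)" using * \<open>x \<le> y\<close> by (simp add: algebra_simps abs_le_iff) }
      { assume "y \<le> x"
        then have "D * (x - y) \<le> M * (x - y)" using D(2) by (intro mult_right_mono) auto
        then show "g z x - g z y \<le> (M + e) * (x - y)" using * \<open>y \<le> x\<close> by (simp add: algebra_simps abs_le_iff) }
    qed (fact \<open>c > 0\<close>)
  qed
  then obtain c where c0: "\<And>x. x \<in> {a..b} - N \<Longrightarrow> c x > 0"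
    and c: "\<And>x y. x \<in> {a..b} - N \<Longrightarrow> y\<in>{a..b} \<Longrightarrow> \<bar>y - x\<bar> < c x \<Longrightarrow>
        (x \<le> y \<longrightarrow> g z y - g z x \<le> (M + e) * (y - x)) \<and>
        (y \<le> x \<longrightarrow> g z x - g z y \<le> (M + e) * (x - y))"
    by metis
  \<comment> \<open>At tags in \<open>N\<close> the radius 1 is a filler: only \<open>G1\<close>
    restricts those intervals.\<close>
  define G where "G x = G1 x \<inter> ball x (if x \<in> {a..b} - N then c x else 1)" for x
  have "gauge G"
    unfolding G_def using G1 c0 by (intro gauge_Int) (auto simp: gauge_def)
  then obtain p where p: "p tagged_division_of {a..b}" and fine: "G fine p"
    using fine_division_exists_real by blast
  have fin: "finite p" using p by auto
  have fine1: "G1 fine p" and fine2: "(\<lambda>x. ball x (if x \<in> {a..b} - N then c x else 1)) fine p"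
    using fine unfolding fine_def G_def by auto
  have pk: "\<exists>u v. k = {u..v} \<and> u \<le> x \<and> x \<le> v \<and> a \<le> u \<and> v \<le> b" if xk: "(x,k) \<in> p" for x k
  proof -
    obtain u v where uv: "k = {u..v}" using tagged_division_ofD(4)[OF p xk] by (metis interval_cbox)
    have "x \<in> k" "k \<subseteq> {a..b}" using tagged_division_ofD(2,3)[OF p xk] by auto
    then show ?thesis using uv by (intro exI[of _ u] exI[of _ v]) auto
  qed
  define pN where "pN = {q \<in> p. fst q \<in> N}"
  define D where "D q = g z (Sup (snd q)) - g z (Inf (snd q))" for q :: "real \<times> real set"
  have pN: "pN \<subseteq> p" "finite pN" using fin by (auto simp: pN_def)
  have "sum D p = g z b - g z a"
    using additive_tagged_division_1[OF ab p, of "g z"] by (simp add: D_def case_prod_unfold)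
  moreover have "sum D p = sum D pN + sum D (p - pN)"
    using fin pN by (simp add: sum.subset_diff add.commute)
  moreover have "sum D (p - pN) \<le> (M + e) * (b - a)"
  proof -
    have "sum D (p - pN) \<le> (\<Sum>q\<in>p - pN. (M + e) * measure lborel (snd q))"
    proof (rule sum_mono)
      fix q assume q: "q \<in> p - pN"
      obtain x k where xk: "q = (x,k)" by fastforce
      obtain u v where uv: "k = {u..v}" "u \<le> x" "x \<le> v" "a \<le> u" "v \<le> b" using pk q xk by blast
      have x: "x \<in> {a..b} - N" using q uv xk by (auto simp: pN_def)
      have "k \<subseteq> ball x (c x)" using fine2 q xk x unfolding fine_def by fastforce
      moreover have "u \<in> k" "v \<in> k" using uv by auto
      ultimately have "u \<in> ball x (c x)" "v \<in> ball x (c x)" by auto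
      then have "\<bar>u - x\<bar> < c x" "\<bar>v - x\<bar> < c x" by (auto simp: dist_real_def)
      then have "g z v - g z x \<le> (M + e) * (v - x)" "g z x - g z u \<le> (M + e) * (x - u)"
        using c[OF x, of v] c[OF x, of u] uv by auto
      then have "g z v - g z u \<le> (M + e) * (v - u)" by (simp add: algebra_simps)
      then show "D q \<le> (M + e) * measure lborel (snd q)" using xk uv by (simp add: D_def)
    qed
    also have "\<dots> \<le> (\<Sum>q\<in>p. (M + e) * measure lborel (snd q))"
      using fin M e by (intro sum_mono2) auto
    also have "\<dots> = (M + e) * (b - a)"
      using additive_content_tagged_division[of p a b] p ab
      by (simp add: sum_distrib_left[symmetric] case_prod_unfold)
    finally show ?thesis .
  qed
  moreover have "sum D pN \<le> e"
  proof -
    \<comment> \<open>An enumeration is required because absolute continuity is stated for indexed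
      families of intervals.\<close>
    obtain \<phi> where \<phi>: "bij_betw \<phi> {..<card pN} pN"
      using ex_bij_betw_nat_finite[OF pN(2)] by (auto simp: atLeast0LessThan)
    define l where "l i = Inf (snd (\<phi> i))" for i
    define r where "r i = Sup (snd (\<phi> i))" for i
    have \<phi>p: "\<phi> i \<in> pN" if "i < card pN" for i using \<phi> that by (auto dest: bij_betwE)
    have lr: "snd (\<phi> i) = {l i..r i} \<and> l i \<le> r i \<and> {l i..r i} \<subseteq> {a..b}" if "i < card pN" for i
    proof -
      have "(fst (\<phi> i), snd (\<phi> i)) \<in> p" using \<phi>p[OF that] pN by auto
      then obtain u v where "snd (\<phi> i) = {u..v}" "u \<le> v" "a \<le> u" "v \<le> b" using pk by (metis order_trans)
      then show ?thesis by (auto simp: l_def r_def)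
    qed
    have "(\<Sum>i<card pN. norm (g z (r i) - g z (l i))) < e"
    proof (rule d[rule_format, OF conjI[OF _ conjI]])
      show "\<forall>i<card pN. l i \<le> r i \<and> {l i..r i} \<subseteq> {a..b}" using lr by auto
      show "\<forall>i<card pN. \<forall>j<card pN. i \<noteq> j \<longrightarrow> {l i<..<r i} \<inter> {l j<..<r j} = {}"
      proof (intro allI impI)
        fix i j assume ij: "i < card pN" "j < card pN" "i \<noteq> j"
        have "\<phi> i \<noteq> \<phi> j" using ij \<phi> unfolding bij_betw_def inj_on_def by auto
        then have "interior (snd (\<phi> i)) \<inter> interior (snd (\<phi> j)) = {}"
          using tagged_division_ofD(5)[OF p, of "fst (\<phi> i)" "snd (\<phi> i)" "fst (\<phi> j)" "snd (\<phi> j)"]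
            \<phi>p[OF ij(1)] \<phi>p[OF ij(2)] pN by (metis prod.collapse subsetD)
        then show "{l i<..<r i} \<inter> {l j<..<r j} = {}" using lr[OF ij(1)] lr[OF ij(2)] by simp
      qed
      have "(\<Sum>i<card pN. r i - l i) = (\<Sum>i<card pN. measure lborel (snd (\<phi> i)))"
        using lr by (intro sum.cong) auto
      also have "\<dots> = (\<Sum>q\<in>pN. measure lborel (snd q))"
        using sum.reindex_bij_betw[OF \<phi>, of "\<lambda>q. measure lborel (snd q)"] by simp
      also have "\<dots> = (\<Sum>q\<in>p. measure lborel (snd q) *\<^sub>R indicat_real N (fst q))"
        unfolding pN_def using fin by (intro sum.mono_neutral_cong_left) (auto simp: indicator_def)
      also have "\<dots> < d"
        using conjunct2[OF G1, THEN spec, THEN mp, OF conjI[OF p fine1]] by (simp add: case_prod_unfold abs_less_iff)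
      finally show "(\<Sum>i<card pN. r i - l i) < d" .
    qed simp
    moreover have "sum D pN = (\<Sum>i<card pN. g z (r i) - g z (l i))"
      using sum.reindex_bij_betw[OF \<phi>, of D] by (simp add: D_def l_def r_def)
    moreover have "\<dots> \<le> (\<Sum>i<card pN. norm (g z (r i) - g z (l i)))" by (intro sum_mono) auto
    ultimately show ?thesis by simp
  qed
  ultimately have "g z b - g z a \<le> e + (M + e) * (b - a)" by simp
  also have "\<dots> = M * (b - a) + e * (b - a + 1)" by (simp add: algebra_simps)
  also have "\<dots> = M * (b - a) + e0" using ab by (simp add: e_def)
  finally show "g z b - g z a \<le> M * (b - a) + e0" .
qed

text \<open>Pairing with the unit vector in the direction of the total increment reduces the claim
  to the scalar case, since along that direction the increment equals its norm.\<close>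

lemma abs_cont_norm_increment_le:
  fixes g :: "'a \<Rightarrow> real \<Rightarrow> 'b::euclidean_space"
  assumes ac: "unif_abs_cont_on {z} {a..b} g" and ab: "a \<le> b" and N: "negligible N"
    and deriv: "\<And>x. x \<in> {a..b} - N \<Longrightarrow>
      \<exists>D. (g z has_vector_derivative D) (at x within {a..b}) \<and> norm D \<le> M"
    and M: "M \<ge> 0"
  shows "norm (g z b - g z a) \<le> M * (b - a)"
proof -
  define u where "u = sgn (g z b - g z a)"
  have u: "norm u \<le> 1" by (simp add: u_def norm_sgn)
  have "u \<bullet> g z b - u \<bullet> g z a \<le> M * (b - a)"
  proof (rule abs_cont_increment_le[where g="\<lambda>z t. u \<bullet> g z t", OF _ ab N])
    show "unif_abs_cont_on {z} {a..b} (\<lambda>z t. u \<bullet> g z t)"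
    proof (rule unif_abs_cont_on_dominated[OF ac, of _ _ 1])
      fix x y :: real assume "x \<le> y"
      have "norm (u \<bullet> g z y - u \<bullet> g z x) \<le> norm u * norm (g z y - g z x)"
        by (simp add: inner_diff_right[symmetric] Cauchy_Schwarz_ineq2)
      also have "\<dots> \<le> 1 * norm (g z y - g z x)" using u by (intro mult_right_mono) auto
      finally show "norm (u \<bullet> g z y - u \<bullet> g z x) \<le> 1 * norm (g z y - g z x) + 1 * (y - x)"
        using \<open>x \<le> y\<close> by simp
    qed simp
    fix x assume "x \<in> {a..b} - N"
    from deriv[OF this] obtain D where D: "(g z has_vector_derivative D) (at x within {a..b})" "norm D \<le> M"
      by blast
    have "((\<lambda>t. u \<bullet> g z t) has_vector_derivative u \<bullet> D) (at x within {a..b})"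
      using bounded_linear.has_vector_derivative[OF bounded_linear_inner_right D(1)] .
    moreover have "u \<bullet> D \<le> M"
      using norm_cauchy_schwarz[of u D] u D(2) mult_mono[of "norm u" 1 "norm D" M] by simp
    ultimately show "\<exists>D. ((\<lambda>t. u \<bullet> g z t) has_real_derivative D) (at x within {a..b}) \<and> D \<le> M"
      by (auto simp: has_real_derivative_iff_has_vector_derivative)
  qed (fact M)
  moreover have "u \<bullet> (g z b - g z a) = norm (g z b - g z a)"
    unfolding u_def sgn_div_norm inner_scaleR_left power2_norm_eq_inner[symmetric] by (cases "g z b = g z a") (simp_all add: power2_eq_square)
  ultimately show ?thesis by (simp add: inner_diff_right)
qed

section \<open>Holomorphic maps and the class \<open>N\<^sub>A\<close>\<close>

lemma cinner_add_left: "cinner (x + y) z = cinner x z + cinner y z"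
  by (simp add: cinner_def sum.distrib distrib_right)

lemma cinner_add_right: "cinner x (y + z) = cinner x y + cinner x z"
  by (simp add: cinner_def sum.distrib distrib_left)

lemma cinner_scale_left: "cinner (c *s x) y = c * cinner x y"
  by (simp add: cinner_def sum_distrib_left mult.assoc)

lemma cinner_scale_right: "cinner x (c *s y) = cnj c * cinner x y"
  by (simp add: cinner_def sum_distrib_left mult_ac)

lemma cinner_zero_left [simp]: "cinner 0 y = 0"
  by (simp add: cinner_def)

lemma Re_cinner: "Re (cinner x y) = x \<bullet> y"
  by (simp add: cinner_def inner_vec_def inner_complex_def)

lemma cinner_self: "cinner x x = of_real ((norm x)\<^sup>2)"
proof -
  have "Im (cinner x x) = 0" by (simp add: cinner_def)
  moreover have "Re (cinner x x) = (norm x)\<^sup>2" by (simp add: Re_cinner power2_norm_eq_inner)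
  ultimately show ?thesis by (simp add: complex_eq_iff)
qed

lemma norm_cinner_le: "norm (cinner x y) \<le> norm x * norm y"
proof -
  have "norm (cinner x y) \<le> (\<Sum>i\<in>UNIV. \<bar>norm (x $ i)\<bar> * \<bar>norm (y $ i)\<bar>)"
    unfolding cinner_def by (rule order_trans[OF norm_sum]) (simp add: norm_mult)
  also have "\<dots> \<le> norm x * norm y"
    unfolding norm_vec_def by (rule L2_set_mult_ineq)
  finally show ?thesis .
qed

lemma of_real_vector_scale: "complex_of_real r *s x = r *\<^sub>R x" for x :: "complex^'n"
  by (simp add: vec_eq_iff) (simp add: scaleR_conv_of_real)

lemma norm_vector_scale: "norm (c *s x) = norm c * norm x" for x :: "complex^'n"
  by (simp add: norm_vec_def norm_mult L2_set_right_distrib)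

lemma bounded_linear_cinner_left: "bounded_linear (\<lambda>x. cinner x y)"
  by (rule linear_conv_bounded_linear[THEN iffD1], rule linearI)
     (simp_all add: cinner_add_left cinner_scale_left of_real_vector_scale[symmetric] scaleR_conv_of_real)

lemma bounded_linear_vector_scale_left: "bounded_linear (\<lambda>c. c *s x)" for x :: "complex^'n"
  by (rule linear_conv_bounded_linear[THEN iffD1], rule linearI)
     (simp_all add: vec_eq_iff distrib_right)

text \<open>The passage from several variables to one: restrict to a complex line and pair with a
  fixed vector e. As \<open>cinner\<close> is complex linear in its first argument, the result is
  holomorphic, and the theorems of Cauchy and Schwarz and the maximum principle apply to it.\<close>

lemma slice_has_field_derivative:
  fixes g :: "complex^'n \<Rightarrow> complex^'n"
  assumes "(g has_derivative (\<lambda>w. M *v w)) (at (x + \<zeta> *s w))"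
  shows "((\<lambda>\<zeta>. cinner (g (x + \<zeta> *s w)) e) has_field_derivative cinner (M *v w) e) (at \<zeta>)"
proof -
  have "((\<lambda>\<zeta>. x + \<zeta> *s w) has_derivative (\<lambda>\<eta>. \<eta> *s w)) (at \<zeta>)"
    using has_derivative_add[OF has_derivative_const
        bounded_linear.has_derivative[OF bounded_linear_vector_scale_left has_derivative_ident]] by simp
  from has_derivative_compose[OF this assms]
  have "((\<lambda>\<zeta>. cinner (g (x + \<zeta> *s w)) e) has_derivative (\<lambda>\<eta>. cinner (M *v (\<eta> *s w)) e)) (at \<zeta>)"
    by (rule bounded_linear.has_derivative[OF bounded_linear_cinner_left])
  moreover have "(\<lambda>\<eta>. cinner (M *v (\<eta> *s w)) e) = (*) (cinner (M *v w) e)"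
    by (simp add: fun_eq_iff vector_scalar_commute cinner_scale_left mult.commute)
  ultimately show ?thesis by (simp add: has_field_derivative_def)
qed

lemma holomorphic_on_slice:
  assumes "holomorphic_map_on g S" and "\<And>\<zeta>. \<zeta> \<in> D \<Longrightarrow> x + \<zeta> *s w \<in> S"
  shows "(\<lambda>\<zeta>. cinner (g (x + \<zeta> *s w)) e) holomorphic_on D"
  unfolding holomorphic_on_def
proof
  fix \<zeta> assume "\<zeta> \<in> D"
  then obtain M where "(g has_derivative (\<lambda>w. M *v w)) (at (x + \<zeta> *s w))"
    using assms unfolding holomorphic_map_on_def by blast
  from slice_has_field_derivative[OF this, of e]
  show "(\<lambda>\<zeta>. cinner (g (x + \<zeta> *s w)) e) field_differentiable at \<zeta> within D"
    by (auto simp: field_differentiable_def intro: has_field_derivative_at_within)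
qed

text \<open>Cauchy's estimate on the disc \<zeta> -> x + \<zeta> w of radius \<rho> / |w|. Pairing
  with e = M w makes the derivative at 0 equal to |M w|^2, and one factor |M w| cancels.\<close>

lemma holomorphic_map_derivative_le:
  fixes g :: "complex^'n \<Rightarrow> complex^'n"
  assumes g: "holomorphic_map_on g S" and S: "cball x \<rho> \<subseteq> S" and \<rho>: "\<rho> > 0"
    and B: "\<And>y. y \<in> cball x \<rho> \<Longrightarrow> norm (g y) \<le> B"
    and M: "(g has_derivative (\<lambda>w. M *v w)) (at x)"
  shows "norm (M *v w) \<le> B / \<rho> * norm w"
proof (cases "w = 0 \<or> M *v w = 0")
  case True
  have "B \<ge> 0" using order_trans[OF norm_ge_zero B[of x]] \<rho> by simp
  then show ?thesis using True \<rho> by auto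
next
  case False
  define e where "e = M *v w"
  define r where "r = \<rho> / norm w"
  define \<phi> where "\<phi> \<zeta> = cinner (g (x + \<zeta> *s w)) e" for \<zeta>
  have r: "r > 0" using False \<rho> by (simp add: r_def)
  have e: "norm e > 0" using False by (simp add: e_def)
  have in_cball: "x + \<zeta> *s w \<in> cball x \<rho>" if "\<zeta> \<in> cball 0 r" for \<zeta>
  proof -
    have "norm (\<zeta> *s w) \<le> r * norm w"
      using that by (simp add: norm_vector_scale mult_right_mono)
    also have "\<dots> = \<rho>" using False by (simp add: r_def)
    finally show ?thesis by (simp add: dist_norm)
  qed
  have hol: "\<phi> holomorphic_on cball 0 r"
    unfolding \<phi>_def by (rule holomorphic_on_slice[OF g]) (use in_cball S in auto)
  have "norm ((deriv ^^ 1) \<phi> 0) \<le> fact 1 * (B * norm e) / r ^ 1"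
  proof (rule Cauchy_inequality)
    show "\<phi> holomorphic_on ball 0 r" using hol by (rule holomorphic_on_subset) auto
    show "continuous_on (cball 0 r) \<phi>" using hol by (rule holomorphic_on_imp_continuous_on)
    fix \<zeta> :: complex assume "norm (0 - \<zeta>) = r"
    then have "norm (g (x + \<zeta> *s w)) \<le> B" by (intro B in_cball) simp
    then show "norm (\<phi> \<zeta>) \<le> B * norm e"
      unfolding \<phi>_def by (intro order_trans[OF norm_cinner_le] mult_right_mono) auto
  qed (fact r)
  moreover have "deriv \<phi> 0 = cinner e e"
    unfolding \<phi>_def e_def by (rule DERIV_imp_deriv, rule slice_has_field_derivative) (simp add: M)
  ultimately have "(norm e)\<^sup>2 \<le> B / r * norm e"
    by (simp add: cinner_self norm_power)
  then have "norm e * norm e \<le> B / r * norm e" by (simp add: power2_eq_square)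
  then have "norm e \<le> B / r" using e by (rule mult_right_le_imp_le)
  then show ?thesis by (simp add: e_def r_def)
qed

text \<open>Each point of the smaller ball has a ball of radius R - r around it inside the larger
  one, so Cauchy's estimate bounds the derivative; convexity of the smaller ball does the
  rest.\<close>

lemma holomorphic_map_lipschitz:
  fixes g :: "complex^'n \<Rightarrow> complex^'n"
  assumes g: "holomorphic_map_on g S" and S: "cball 0 R \<subseteq> S" and r: "r < R"
    and B: "\<And>y. y \<in> cball 0 R \<Longrightarrow> norm (g y) \<le> B"
    and x: "x \<in> cball 0 r" and y: "y \<in> cball 0 r"
  shows "norm (g x - g y) \<le> B / (R - r) * norm (x - y)"
proof -
  have sub: "cball u (R - r) \<subseteq> cball 0 R" if u: "u \<in> cball 0 r" for u :: "complex^'n"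
  proof
    fix y assume "y \<in> cball u (R - r)"
    then have "dist u y \<le> R - r" "dist 0 u \<le> r" using u by auto
    then have "dist 0 y \<le> R" using dist_triangle[of 0 y u] by linarith
    then show "y \<in> cball 0 R" by simp
  qed
  have "u \<in> S" if u: "u \<in> cball 0 r" for u
    using sub[OF u] S r by (auto simp: subset_iff)
  then obtain M where M: "\<And>u. u \<in> cball 0 r \<Longrightarrow> (g has_derivative (\<lambda>w. M u *v w)) (at u)"
    using g unfolding holomorphic_map_on_def by metis
  show ?thesis
  proof (rule differentiable_bound[of "cball 0 r" _ "\<lambda>u w. M u *v w"])
    fix u :: "complex^'n" assume u: "u \<in> cball 0 r"
    show "(g has_derivative (*v) (M u)) (at u within cball 0 r)"
      using M[OF u] by (rule has_derivative_at_withinI)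
    show "onorm ((*v) (M u)) \<le> B / (R - r)"
      by (rule onorm_le, rule holomorphic_map_derivative_le[OF g _ _ _ M[OF u]])
         (use sub[OF u] S r B in auto)
  qed (use x y in auto)
qed

text \<open>The Cayley transform (p - p(0)) / (p + cnj p(0)) maps the right half-plane into the unit
  disc and sends p(0) to 0, so the Schwarz lemma bounds it by |z|. Both inequalities are read off
  from this; p(0) need not be real.\<close>

lemma positive_real_part_bounds:
  assumes hol: "p holomorphic_on ball 0 1" and pos: "\<And>z. z \<in> ball 0 1 \<Longrightarrow> Re (p z) > 0"
    and z: "norm z < 1"
  shows "Re (p 0) * (1 - norm z) / (1 + norm z) \<le> Re (p z)"
    and "norm (p z) \<le> norm (p 0) * (1 + norm z) / (1 - norm z)"
proof -
  define a where "a = Re (p 0)"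
  define \<rho> where "\<rho> = norm z"
  define x where "x = Re (p z)"
  have a: "a > 0" using pos[of 0] by (simp add: a_def)
  have \<rho>: "0 \<le> \<rho>" "\<rho> < 1" using z by (auto simp: \<rho>_def)
  have nz: "p w + cnj (p 0) \<noteq> 0" if "w \<in> ball 0 1" for w
  proof -
    have "Re (p w + cnj (p 0)) > 0" using pos[OF that] a by (simp add: a_def)
    then show ?thesis by force
  qed
  have sq: "(norm (q - p 0))\<^sup>2 = (norm (q + cnj (p 0)))\<^sup>2 - 4 * a * Re q" for q
    unfolding cmod_power2 a_def by (simp add: power2_eq_square algebra_simps)
  have "norm ((p z - p 0) / (p z + cnj (p 0))) \<le> norm z"
  proof (rule Schwarz_Lemma(1))
    show "(\<lambda>z. (p z - p 0) / (p z + cnj (p 0))) holomorphic_on ball 0 1"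
      using hol nz by (intro holomorphic_intros) auto
    fix w :: complex assume "norm w < 1"
    then have w: "w \<in> ball 0 1" by simp
    have "(norm (p w - p 0))\<^sup>2 < (norm (p w + cnj (p 0)))\<^sup>2"
      using sq[of "p w"] a pos[OF w] by simp
    then have "norm (p w - p 0) < norm (p w + cnj (p 0))" by (rule power2_less_imp_less) simp
    then show "norm ((p w - p 0) / (p w + cnj (p 0))) < 1"
      using nz[OF w] by (simp add: norm_divide)
  qed (use z in auto)
  then have le: "norm (p z - p 0) \<le> \<rho> * norm (p z + cnj (p 0))"
    using nz[of z] z by (simp add: norm_divide divide_simps \<rho>_def)
  have "norm (p z) \<le> norm (p 0) + norm (p z - p 0)" by (metis norm_triangle_sub add.commute)
  also have "\<dots> \<le> norm (p 0) + \<rho> * (norm (p z) + norm (p 0))"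
    using le norm_triangle_ineq[of "p z" "cnj (p 0)"] \<rho> by (smt (verit) complex_mod_cnj mult_left_mono)
  finally show "norm (p z) \<le> norm (p 0) * (1 + norm z) / (1 - norm z)"
    using \<rho> by (simp add: field_simps \<rho>_def[symmetric])
  have "(norm (p z - p 0))\<^sup>2 \<le> (\<rho> * norm (p z + cnj (p 0)))\<^sup>2"
    using le by (intro power_mono) auto
  then have "(norm (p z + cnj (p 0)))\<^sup>2 * (1 - \<rho>\<^sup>2) \<le> 4 * a * x"
    using sq[of "p z"] by (simp add: power_mult_distrib algebra_simps x_def)
  moreover have "(x + a)\<^sup>2 \<le> (norm (p z + cnj (p 0)))\<^sup>2"
    by (simp add: cmod_power2 x_def a_def)
  then have "(x + a)\<^sup>2 * (1 - \<rho>\<^sup>2) \<le> (norm (p z + cnj (p 0)))\<^sup>2 * (1 - \<rho>\<^sup>2)"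
    using \<rho> by (intro mult_right_mono) (auto simp: power_le_one)
  ultimately have quad: "(x + a)\<^sup>2 * (1 - \<rho>\<^sup>2) \<le> 4 * a * x" by simp
  \<comment> \<open>The inequality \<open>quad\<close> says that (a (1 - \<rho>) - x (1 + \<rho>))
    (a (1 + \<rho>) - x (1 - \<rho>)) is at most 0. Were the first factor positive, the second would
    be too.\<close>
  have "a * (1 - \<rho>) \<le> x * (1 + \<rho>)"
  proof (rule ccontr)
    assume "\<not> ?thesis"
    then have D: "a * (1 - \<rho>) - x * (1 + \<rho>) > 0" by simp
    have x0: "x > 0" using pos[of z] z by (simp add: x_def)
    have "a * (1 + \<rho>) - x * (1 - \<rho>) > 0"
    proof -
      have "x * (1 - \<rho>) \<le> x * (1 + \<rho>)" "a * (1 - \<rho>) \<le> a * (1 + \<rho>)"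
        using \<rho> a x0 by (auto intro: mult_left_mono)
      then show ?thesis using D by simp
    qed
    from mult_pos_pos[OF D this] quad show False by (simp add: power2_eq_square algebra_simps)
  qed
  then show "Re (p 0) * (1 - norm z) / (1 + norm z) \<le> Re (p z)"
    using \<rho> by (simp add: field_simps \<rho>_def[symmetric] a_def[symmetric] x_def[symmetric])
qed

section \<open>Numerical values and size of maps in the class\<close>

lemma m_lower_le:
  assumes "norm z = 1" shows "m_lower A \<le> Re (cinner (A *v z) z)"
  unfolding m_lower_def
proof (rule cInf_lower)
  show "bdd_below {Re (cinner (A *v z) z) |z. norm z = 1}"
  proof (rule bdd_belowI)
    fix y assume "y \<in> {Re (cinner (A *v z) z) |z. norm z = 1}"
    then obtain z where z: "y = Re (cinner (A *v z) z)" "norm z = 1" by blast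
    have "\<bar>y\<bar> \<le> norm (A *v z) * norm z"
      unfolding z(1) by (rule order_trans[OF abs_Re_le_cmod norm_cinner_le])
    also have "\<dots> \<le> onorm ((*v) A)"
      using onorm[OF matrix_vector_mul_bounded_linear, of A z] z by simp
    finally show "- onorm ((*v) A) \<le> y" by simp
  qed
qed (use assms in auto)

text \<open>For the unit vector u = z / |z| the function \<zeta> -> <h(\<zeta> u), u> vanishes at 0.
  Its quotient p by \<zeta> has p(0) = <A u, u>, and <h(\<zeta> u), \<zeta> u> = |\<zeta>|^2
  p(\<zeta>). So p has positive real part and the one-variable bounds apply at \<zeta> =
  |z|.\<close>

lemma class_N_bounds:
  fixes A :: "complex^'n^'n"
  assumes h: "h \<in> class_N A" and A: "m_lower A > 0" and z: "norm z < 1"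
  shows "m_lower A * (norm z)\<^sup>2 * (1 - norm z) / (1 + norm z) \<le> Re (cinner (h z) z)"
    and "norm (cinner (h z) z) \<le> onorm ((*v) A) * (1 + norm z) / (1 - norm z)"
proof -
  have hol: "holomorphic_map_on h (ball 0 1)" and h0: "h 0 = 0"
    and Dh: "(h has_derivative (\<lambda>w. A *v w)) (at 0)"
    and pos: "\<And>z. z \<in> ball 0 1 - {0} \<Longrightarrow> Re (cinner (h z) z) > 0"
    using h by (auto simp: class_N_def)
  have K: "norm (A *v u) \<le> onorm ((*v) A) * norm u" for u
    by (rule onorm[OF matrix_vector_mul_bounded_linear])
  have K0: "onorm ((*v) A) \<ge> 0" by (rule onorm_pos_le[OF matrix_vector_mul_bounded_linear])
  have "m_lower A * (norm z)\<^sup>2 * (1 - norm z) / (1 + norm z) \<le> Re (cinner (h z) z) \<and>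
     norm (cinner (h z) z) \<le> onorm ((*v) A) * (1 + norm z) / (1 - norm z)"
  proof (cases "z = 0")
    case True
    then show ?thesis using K0 by (simp add: h0)
  next
    case False
    define \<rho> where "\<rho> = norm z"
    have \<rho>: "0 < \<rho>" "\<rho> < 1" using z False by (auto simp: \<rho>_def)
    define u where "u = (1 / \<rho>) *\<^sub>R z"
    have u: "norm u = 1" using \<rho> by (simp add: u_def \<rho>_def)
    have zu: "z = complex_of_real \<rho> *s u" using \<rho> by (simp add: u_def of_real_vector_scale)
    define q where "q \<zeta> = cinner (h (\<zeta> *s u)) u" for \<zeta>
    define p where "p \<zeta> = (if \<zeta> = 0 then deriv q 0 else (q \<zeta> - q 0) / (\<zeta> - 0))" for \<zeta>
    have "q holomorphic_on ball 0 1"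
      using holomorphic_on_slice[OF hol, of "ball 0 1" 0 u u] u
      by (simp add: q_def[abs_def] norm_vector_scale)
    then have holp: "p holomorphic_on ball 0 1"
      unfolding p_def by (rule pole_lemma) simp
    have q0: "q 0 = 0" by (simp add: q_def h0)
    have p0: "p 0 = cinner (A *v u) u"
      using slice_has_field_derivative[of h A 0 0 u u] Dh
      by (simp add: p_def q_def[abs_def] DERIV_imp_deriv)
    have hp: "cinner (h (\<zeta> *s u)) (\<zeta> *s u) = of_real ((norm \<zeta>)\<^sup>2) * p \<zeta>" for \<zeta>
    proof (cases "\<zeta> = 0")
      case False
      then have "of_real ((norm \<zeta>)\<^sup>2) * p \<zeta> = cnj \<zeta> * q \<zeta>"
        unfolding complex_norm_square by (simp add: p_def q0)
      then show ?thesis by (simp add: cinner_scale_right q_def)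
    qed (simp add: h0)
    have m: "m_lower A \<le> Re (p 0)" unfolding p0 using u by (rule m_lower_le)
    \<comment> \<open>At 0 positivity comes from m(A) > 0, elsewhere from the defining inequality of
      the class.\<close>
    have posp: "Re (p \<zeta>) > 0" if "\<zeta> \<in> ball 0 1" for \<zeta>
    proof (cases "\<zeta> = 0")
      case True
      then show ?thesis using m A by simp
    next
      case False
      moreover have "norm (\<zeta> *s u) = norm \<zeta>" using u by (simp add: norm_vector_scale)
      ultimately have "\<zeta> *s u \<in> ball 0 1 - {0}" using that by (metis Diff_iff mem_ball_0 norm_eq_zero singletonD)
      from pos[OF this] show ?thesis unfolding hp by (simp add: zero_less_mult_iff)
    qed
    note bounds = positive_real_part_bounds[OF holp posp, of "of_real \<rho>"]
    have cz: "cinner (h z) z = of_real (\<rho>\<^sup>2) * p (of_real \<rho>)"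
      using hp[of "of_real \<rho>"] \<rho> by (simp add: zu[symmetric])
    have "m_lower A * (1 - \<rho>) / (1 + \<rho>) \<le> Re (p 0) * (1 - \<rho>) / (1 + \<rho>)"
      using m \<rho> by (intro divide_right_mono mult_right_mono) auto
    also have "\<dots> \<le> Re (p (of_real \<rho>))" using bounds(1) \<rho> by simp
    finally have "\<rho>\<^sup>2 * (m_lower A * (1 - \<rho>) / (1 + \<rho>)) \<le> \<rho>\<^sup>2 * Re (p (of_real \<rho>))"
      by (intro mult_left_mono) auto
    then have 1: "m_lower A * (norm z)\<^sup>2 * (1 - norm z) / (1 + norm z) \<le> Re (cinner (h z) z)"
      unfolding cz \<rho>_def[symmetric] by (simp add: mult_ac)
    have "norm (p 0) \<le> onorm ((*v) A)"
      unfolding p0 using order_trans[OF norm_cinner_le[of "A *v u" u]] K[of u] u by simp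
    then have "norm (p 0) * (1 + \<rho>) / (1 - \<rho>) \<le> onorm ((*v) A) * (1 + \<rho>) / (1 - \<rho>)"
      using \<rho> by (intro divide_right_mono mult_right_mono) auto
    with bounds(2) \<rho> have "norm (p (of_real \<rho>)) \<le> onorm ((*v) A) * (1 + \<rho>) / (1 - \<rho>)" by simp
    moreover have "\<rho>\<^sup>2 * norm (p (of_real \<rho>)) \<le> 1 * norm (p (of_real \<rho>))"
      using \<rho> by (intro mult_right_mono) (auto simp: power_le_one)
    ultimately show ?thesis using 1 unfolding cz \<rho>_def[symmetric] by (simp add: norm_mult norm_power)
  qed
  then show "m_lower A * (norm z)\<^sup>2 * (1 - norm z) / (1 + norm z) \<le> Re (cinner (h z) z)"
    and "norm (cinner (h z) z) \<le> onorm ((*v) A) * (1 + norm z) / (1 - norm z)" by blast+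
qed

text \<open>On the unit circle \<open>|\<langle>h(x), x\<rangle>|\<close> at \<open>x = z + \<zeta>w\<close> is the modulus of the holomorphic function
  \<open>\<zeta> \<langle>h(z + \<zeta>w), z\<rangle> + \<langle>h(z + \<zeta>w), w\<rangle>\<close>, whose value at \<open>0\<close> is \<open>\<langle>h(z), w\<rangle>\<close>; so the bound on the
  numerical values carries over to \<open>h\<close> itself by the maximum principle.\<close>

lemma class_N_locally_bounded:
  fixes A :: "complex^'n^'n"
  assumes A: "m_lower A > 0" and r: "0 \<le> r" "r < 1"
  shows "\<exists>B\<ge>0. \<forall>h\<in>class_N A. \<forall>z. norm z \<le> r \<longrightarrow> norm (h z) \<le> B"
proof -
  define c where "c = (1 - r) / 2"
  \<comment> \<open>\<open>M\<close> depends on A and r alone, so the final bound is common to all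
    members of the class and hence to all times t.\<close>
  define M where "M = onorm ((*v) A) * 2 / c"
  have c: "c > 0" "r + c < 1" "1 - (r + c) = c" using r by (auto simp: c_def field_simps)
  have K0: "onorm ((*v) A) \<ge> 0" by (rule onorm_pos_le[OF matrix_vector_mul_bounded_linear])
  have "M / c \<ge> 0" using K0 c by (simp add: M_def)
  moreover have "norm (h z) \<le> M / c" if h: "h \<in> class_N A" and z: "norm z \<le> r" for h z
  proof (cases "h z = 0")
    case True then show ?thesis using K0 c by (simp add: M_def)
  next
    case False
    have hol: "holomorphic_map_on h (ball 0 1)" using h by (simp add: class_N_def)
    \<comment> \<open>This direction makes <h(z), w> = c |h(z)|, and the length c keeps the disc z +
      \<zeta> w at distance at least c from the unit sphere.\<close>
    define w where "w = (c / norm (h z)) *\<^sub>R h z"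
    have w: "norm w = c" using False c by (simp add: w_def)
    have nx: "norm (z + \<zeta> *s w) \<le> r + c" if nz: "norm \<zeta> \<le> 1" for \<zeta>
    proof -
      have "norm (z + \<zeta> *s w) \<le> norm z + norm \<zeta> * norm w"
        by (metis norm_triangle_ineq norm_vector_scale)
      also have "\<dots> \<le> r + 1 * c" using z nz w c by (intro add_mono mult_mono) auto
      finally show ?thesis by simp
    qed
    define G where "G \<zeta> = \<zeta> * cinner (h (z + \<zeta> *s w)) z + cinner (h (z + \<zeta> *s w)) w" for \<zeta>
    have holG: "G holomorphic_on cball 0 1"
      unfolding G_def
      by (intro holomorphic_intros holomorphic_on_slice[OF hol]) (use nx c in \<open>force+\<close>)
    have "norm (G 0) \<le> M"
    proof (rule maximum_modulus_frontier[of G "cball 0 1"])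
      show "G holomorphic_on interior (cball 0 1)"
        using holG by (rule holomorphic_on_subset) (rule interior_subset)
      show "continuous_on (closure (cball 0 1)) G"
        using holomorphic_on_imp_continuous_on[OF holG] by simp
      fix \<zeta> :: complex assume "\<zeta> \<in> frontier (cball 0 1)"
      then have \<zeta>: "norm \<zeta> = 1" by (simp add: frontier_cball)
      define x where "x = z + \<zeta> *s w"
      have nx': "norm x \<le> r + c" using nx \<zeta> by (simp add: x_def)
      have "\<zeta> * cnj \<zeta> = 1" using \<zeta> by (simp add: complex_norm_square[symmetric])
      then have "G \<zeta> = \<zeta> * cinner (h x) x"
        by (simp add: G_def x_def cinner_add_right cinner_scale_right distrib_left mult.assoc[symmetric])
      then have "norm (G \<zeta>) = norm (cinner (h x) x)" using \<zeta> by (simp add: norm_mult)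
      also have "\<dots> \<le> onorm ((*v) A) * (1 + norm x) / (1 - norm x)"
        using nx' c by (intro class_N_bounds(2)[OF h A]) auto
      also have "\<dots> \<le> onorm ((*v) A) * 2 / c"
        using nx' c K0 by (intro frac_le mult_left_mono mult_nonneg_nonneg) auto
      finally show "norm (G \<zeta>) \<le> M" by (simp add: M_def)
    qed auto
    moreover have "G 0 = of_real (c * norm (h z))"
      using False by (simp add: G_def w_def of_real_vector_scale[symmetric] cinner_scale_right cinner_self power2_eq_square)
    ultimately have "\<bar>c * norm (h z)\<bar> \<le> M" by (simp only: norm_of_real)
    then have "c * norm (h z) \<le> M" by linarith
    then show ?thesis using c by (simp add: field_simps)
  qed
  ultimately show ?thesis by blast
qed

section \<open>The matrix exponential\<close>

lemma has_vector_derivative_vecI: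
  fixes f :: "real \<Rightarrow> 'a::euclidean_space^'n"
  assumes "\<And>i. ((\<lambda>t. f t $ i) has_vector_derivative f' $ i) (at t within S)"
  shows "(f has_vector_derivative f') (at t within S)"
  unfolding has_vector_derivative_def
proof (subst has_derivative_componentwise_within, rule ballI)
  fix b :: "'a^'n" assume "b \<in> Basis"
  then obtain i c where b: "b = axis i c" by (auto simp: Basis_vec_def)
  show "((\<lambda>x. f x \<bullet> b) has_derivative (\<lambda>x. (x *\<^sub>R f') \<bullet> b)) (at t within S)"
    using bounded_linear.has_vector_derivative[OF bounded_linear_inner_left assms[of i], of c]
    by (simp add: b inner_axis has_vector_derivative_def)
qed

lemma bounded_bilinear_matrix_vector_mult:
  "bounded_bilinear ((*v) :: complex^'n^'n \<Rightarrow> complex^'n \<Rightarrow> complex^'n)"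
  unfolding bilinear_conv_bounded_bilinear[symmetric] bilinear_def
  by (auto intro!: linearI simp: matrix_vector_right_distrib matrix_vector_mult_add_rdistrib)
     (simp_all add: vec_eq_iff matrix_vector_mult_def scaleR_sum_right)

lemma bounded_bilinear_vector_scale:
  "bounded_bilinear ((*s) :: complex \<Rightarrow> complex^'n \<Rightarrow> complex^'n)"
  unfolding bilinear_conv_bounded_bilinear[symmetric] bilinear_def
  by (auto intro!: linearI simp: vec_eq_iff algebra_simps)

definition matrix_power :: "complex^'n^'n \<Rightarrow> nat \<Rightarrow> complex^'n^'n" where
  "matrix_power A k = (((**) A) ^^ k) (mat 1)"

lemma matrix_power_0 [simp]: "matrix_power A 0 = mat 1"
  and matrix_power_Suc: "matrix_power A (Suc k) = A ** matrix_power A k"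
  by (simp_all add: matrix_power_def)

lemma matrix_power_Suc_right: "matrix_power A (Suc k) = matrix_power A k ** A"
proof (induction k)
  case (Suc k)
  then show ?case by (metis matrix_power_Suc matrix_mul_assoc)
qed (simp add: matrix_power_Suc)

lemma matrix_scaleR_left: "(t *\<^sub>R A) ** B = t *\<^sub>R (A ** B)" for A B :: "complex^'n^'n"
  by (simp add: vec_eq_iff matrix_matrix_mult_def scaleR_sum_right)

lemma matrix_scaleR_right: "A ** (t *\<^sub>R B) = t *\<^sub>R (A ** B)" for A B :: "complex^'n^'n"
  by (simp add: vec_eq_iff matrix_matrix_mult_def scaleR_sum_right)

lemma matrix_power_scaleR: "matrix_power (t *\<^sub>R A) k = (t ^ k) *\<^sub>R matrix_power A k"
  by (induction k) (simp_all add: matrix_power_Suc matrix_scaleR_left matrix_scaleR_right)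

lemma norm_matrix_power_mult_le:
  "norm (matrix_power A k *v x) \<le> onorm ((*v) A) ^ k * norm x"
proof (induction k)
  case (Suc k)
  have "norm (matrix_power A (Suc k) *v x) \<le> onorm ((*v) A) * norm (matrix_power A k *v x)"
    using onorm[OF matrix_vector_mul_bounded_linear, of A "matrix_power A k *v x"]
    by (simp add: matrix_power_Suc matrix_vector_mul_assoc)
  also have "\<dots> \<le> onorm ((*v) A) * (onorm ((*v) A) ^ k * norm x)"
    by (intro mult_left_mono Suc.IH onorm_pos_le matrix_vector_mul_bounded_linear)
  finally show ?case by (simp add: mult_ac)
qed simp

lemma norm_matrix_power_entry_le: "norm (matrix_power A k $ i $ j) \<le> onorm ((*v) A) ^ k"
proof -
  have "norm (matrix_power A k $ i $ j) = norm ((matrix_power A k *v axis j 1) $ i)"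
    by (simp add: matrix_vector_mult_def axis_def mult_delta_right)
  also have "\<dots> \<le> norm (matrix_power A k *v axis j 1)" by (rule Finite_Cartesian_Product.norm_nth_le)
  also have "\<dots> \<le> onorm ((*v) A) ^ k" using norm_matrix_power_mult_le[of A k "axis j 1"] by simp
  finally show ?thesis .
qed

text \<open>The variable is complex so that each entry of the exponential is a scalar power series,
  open to termwise differentiation. The majorant is the exponential series of \<open>onorm\<close>
  of A times |\<zeta>|.\<close>

lemma summable_matrix_power_entry:
  "summable (\<lambda>k. matrix_power A k $ i $ j / fact k * \<zeta> ^ k)"
proof (rule summable_comparison_test')
  show "summable (\<lambda>k. inverse (fact k) * (onorm ((*v) A) * norm \<zeta>) ^ k)" by (rule summable_exp)
  fix k
  show "norm (matrix_power A k $ i $ j / fact k * \<zeta> ^ k) \<le> inverse (fact k) * (onorm ((*v) A) * norm \<zeta>) ^ k"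
    using norm_matrix_power_entry_le[of A k i j]
    by (simp add: norm_mult norm_divide norm_power power_mult_distrib divide_simps mult_right_mono)
qed

lemma mexp_entry:
  "mexp (t *\<^sub>R A) $ i $ j = (\<Sum>k. matrix_power A k $ i $ j / fact k * of_real t ^ k)"
proof -
  define S where "S = (\<chi> i j. \<Sum>k. matrix_power A k $ i $ j / fact k * of_real t ^ k)"
  have "(\<lambda>k. (1 / fact k) *\<^sub>R (((**) (t *\<^sub>R A)) ^^ k) (mat 1)) sums S"
    unfolding sums_def
  proof (rule vec_tendstoI, rule vec_tendstoI)
    fix i j
    have "(\<lambda>k. matrix_power A k $ i $ j / fact k * of_real t ^ k) sums S $ i $ j"
      unfolding S_def using summable_sums[OF summable_matrix_power_entry] by simp
    moreover have "((1 / fact k) *\<^sub>R (((**) (t *\<^sub>R A)) ^^ k) (mat 1)) $ i $ j =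
        matrix_power A k $ i $ j / fact k * of_real t ^ k" for k
      unfolding matrix_power_def[symmetric] matrix_power_scaleR
      by simp (simp add: scaleR_conv_of_real)
    ultimately show "(\<lambda>n. (\<Sum>k<n. (1 / fact k) *\<^sub>R (((**) (t *\<^sub>R A)) ^^ k) (mat 1)) $ i $ j)
        \<longlonglongrightarrow> S $ i $ j"
      by (simp add: sums_def)
  qed
  then have "mexp (t *\<^sub>R A) = S" unfolding mexp_def by (simp add: sums_iff)
  then show ?thesis by (simp add: S_def)
qed

text \<open>Powers of A commute with A, so both products have the same entry series. It is also the
  termwise derivative of the exponential series, which makes it the link to the differential
  equation of e^{tA}.\<close>

lemma mexp_mult_entry:
  "(A ** mexp (t *\<^sub>R A)) $ i $ j = (\<Sum>k. matrix_power A (Suc k) $ i $ j / fact k * of_real t ^ k)"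
  "(mexp (t *\<^sub>R A) ** A) $ i $ j = (\<Sum>k. matrix_power A (Suc k) $ i $ j / fact k * of_real t ^ k)"
proof -
  have s: "(\<lambda>k. matrix_power A k $ i $ j / fact k * of_real t ^ k) sums mexp (t *\<^sub>R A) $ i $ j" for i j
    unfolding mexp_entry by (rule summable_sums[OF summable_matrix_power_entry])
  have "(\<lambda>k. \<Sum>l\<in>UNIV. A $ i $ l * (matrix_power A k $ l $ j / fact k * of_real t ^ k))
      sums (A ** mexp (t *\<^sub>R A)) $ i $ j"
    unfolding matrix_matrix_mult_def vec_lambda_beta by (intro sums_sum sums_mult s)
  moreover have "(\<Sum>l\<in>UNIV. A $ i $ l * (matrix_power A k $ l $ j / fact k * of_real t ^ k)) =
      matrix_power A (Suc k) $ i $ j / fact k * of_real t ^ k" for k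
    by (simp add: matrix_power_Suc matrix_matrix_mult_def sum_distrib_right sum_divide_distrib mult.assoc)
  ultimately show "(A ** mexp (t *\<^sub>R A)) $ i $ j = (\<Sum>k. matrix_power A (Suc k) $ i $ j / fact k * of_real t ^ k)"
    by (simp add: sums_iff)
  have "(\<lambda>k. \<Sum>l\<in>UNIV. matrix_power A k $ i $ l / fact k * of_real t ^ k * A $ l $ j)
      sums (mexp (t *\<^sub>R A) ** A) $ i $ j"
    unfolding matrix_matrix_mult_def vec_lambda_beta by (intro sums_sum sums_mult2 s)
  moreover have "(\<Sum>l\<in>UNIV. matrix_power A k $ i $ l / fact k * of_real t ^ k * A $ l $ j) =
      matrix_power A (Suc k) $ i $ j / fact k * of_real t ^ k" for k
    by (simp add: matrix_power_Suc_right matrix_matrix_mult_def sum_distrib_left sum_divide_distrib mult_ac)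
  ultimately show "(mexp (t *\<^sub>R A) ** A) $ i $ j = (\<Sum>k. matrix_power A (Suc k) $ i $ j / fact k * of_real t ^ k)"
    by (simp add: sums_iff)
qed

lemma mexp_commute: "mexp (t *\<^sub>R A) ** A = A ** mexp (t *\<^sub>R A)"
  by (simp add: vec_eq_iff mexp_mult_entry)

lemma mexp_has_vector_derivative:
  "((\<lambda>t. mexp (t *\<^sub>R A)) has_vector_derivative A ** mexp (t *\<^sub>R A)) (at t within S)"
proof (rule has_vector_derivative_vecI, rule has_vector_derivative_vecI)
  fix i j
  let ?c = "\<lambda>k. matrix_power A k $ i $ j / fact k"
  have "((\<lambda>\<zeta>. \<Sum>k. ?c k * \<zeta> ^ k) has_field_derivative (\<Sum>k. diffs ?c k * of_real t ^ k)) (at (of_real t))"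
    by (rule termdiffs_strong_converges_everywhere) (rule summable_matrix_power_entry)
  moreover have "diffs ?c = (\<lambda>k. matrix_power A (Suc k) $ i $ j / fact k)"
    by (simp add: diffs_def fun_eq_iff divide_simps del: of_nat_Suc)
  ultimately show "((\<lambda>t. mexp (t *\<^sub>R A) $ i $ j) has_vector_derivative (A ** mexp (t *\<^sub>R A)) $ i $ j) (at t within S)"
    unfolding mexp_mult_entry mexp_entry by (intro has_vector_derivative_real_field) simp
qed

lemma mexp_0: "mexp (0 :: complex^'n^'n) = mat 1"
proof -
  have "mexp (0 *\<^sub>R (0 :: complex^'n^'n)) $ i $ j = mat 1 $ i $ j" for i j
    unfolding mexp_entry of_real_0 powser_zero by simp
  then show ?thesis by (simp add: vec_eq_iff)
qed

lemma mexp_mult_has_vector_derivative: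
  "((\<lambda>t. mexp (t *\<^sub>R A) *v x) has_vector_derivative A *v (mexp (t *\<^sub>R A) *v x)) (at t within S)"
  using bounded_linear.has_vector_derivative[OF
      bounded_bilinear.bounded_linear_left[OF bounded_bilinear_matrix_vector_mult] mexp_has_vector_derivative]
  by (simp add: matrix_vector_mul_assoc)

text \<open>The left side has derivative zero in t because A commutes with its exponential, hence it
  keeps its value x at t = 0. Since t may have either sign, e^{tA} e^{-tA} x = x is covered
  too.\<close>

lemma mexp_uminus_mult: "mexp (- t *\<^sub>R A) *v (mexp (t *\<^sub>R A) *v x) = x"
proof -
  have d: "((\<lambda>t. mexp (- t *\<^sub>R A)) has_vector_derivative - (A ** mexp (- t *\<^sub>R A))) (at t)" for t
    using vector_diff_chain_at[of uminus "- 1" t "\<lambda>t. mexp (t *\<^sub>R A)"] mexp_has_vector_derivative[of A "- t" UNIV]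
    by (simp add: o_def has_vector_derivative_minus[OF has_vector_derivative_id])
  have "((\<lambda>t. mexp (- t *\<^sub>R A) *v (mexp (t *\<^sub>R A) *v x)) has_derivative (\<lambda>h. 0)) (at t within UNIV)" for t
  proof -
    have "((\<lambda>t. mexp (- t *\<^sub>R A) *v (mexp (t *\<^sub>R A) *v x)) has_vector_derivative
      mexp (- t *\<^sub>R A) *v (A *v (mexp (t *\<^sub>R A) *v x)) + (- (A ** mexp (- t *\<^sub>R A))) *v (mexp (t *\<^sub>R A) *v x)) (at t)"
      by (rule bounded_bilinear.has_vector_derivative[OF bounded_bilinear_matrix_vector_mult d
            mexp_mult_has_vector_derivative])
    moreover have "mexp (- t *\<^sub>R A) *v (A *v y) = (A ** mexp (- t *\<^sub>R A)) *v y" for y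
      by (metis matrix_vector_mul_assoc mexp_commute)
    ultimately show ?thesis
      by (simp add: has_vector_derivative_def bounded_bilinear.minus_left[OF bounded_bilinear_matrix_vector_mult])
  qed
  then obtain c where "\<And>t. mexp (- t *\<^sub>R A) *v (mexp (t *\<^sub>R A) *v x) = c"
    using has_derivative_zero_constant[of UNIV "\<lambda>t. mexp (- t *\<^sub>R A) *v (mexp (t *\<^sub>R A) *v x)"] by auto
  from this[of t] this[of 0] show ?thesis by (simp add: mexp_0)
qed

section \<open>Polynomials in a matrix acting on vectors, by the Horner scheme\<close>

definition poly_mult_vec :: "complex^'n^'n \<Rightarrow> complex poly \<Rightarrow> complex^'n \<Rightarrow> complex^'n" where
  "poly_mult_vec A p x = fold_coeffs (\<lambda>a y. a *s x + A *v y) p 0"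

lemma poly_mult_vec_0 [simp]: "poly_mult_vec A 0 x = 0"
  by (simp add: poly_mult_vec_def)

lemma poly_mult_vec_pCons [simp]: "poly_mult_vec A (pCons a p) x = a *s x + A *v poly_mult_vec A p x"
  by (cases "p = 0"; cases "a = 0") (simp_all add: poly_mult_vec_def)

lemma poly_mult_vec_add: "poly_mult_vec A (p + q) x = poly_mult_vec A p x + poly_mult_vec A q x"
  by (induction p q rule: poly_induct2)
     (simp_all add: matrix_vector_right_distrib vector_sadd_rdistrib add_ac)

lemma poly_mult_vec_smult: "poly_mult_vec A (smult c p) x = c *s poly_mult_vec A p x"
  by (induction p) (simp_all add: vector_scalar_commute vector_add_ldistrib)

lemma poly_mult_vec_sum: "poly_mult_vec A (sum f I) x = (\<Sum>i\<in>I. poly_mult_vec A (f i) x)"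
  by (induction I rule: infinite_finite_induct) (simp_all add: poly_mult_vec_add)

lemma poly_mult_vec_mult: "poly_mult_vec A (p * q) x = poly_mult_vec A p (poly_mult_vec A q x)"
  by (induction p) (simp_all add: poly_mult_vec_add poly_mult_vec_smult)

lemma poly_mult_vec_monom: "poly_mult_vec A (monom c k) x = c *s (matrix_power A k *v x)"
  by (induction k)
     (simp_all add: monom_0 monom_Suc matrix_power_Suc vector_scalar_commute matrix_vector_mul_assoc[symmetric])

text \<open>A dimension count: the powers of A up to the real dimension of the matrix space are one
  too many to be independent. The coefficients of the relation are real and are read as complex
  ones.\<close>

lemma ex_annihilating_poly:
  fixes A :: "complex^'n^'n"
  shows "\<exists>p. p \<noteq> 0 \<and> (\<forall>x. poly_mult_vec A p x = 0)"
\<comment> \<open>Linear dependence concerns sets, in which coinciding powers collapse; a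
  coincidence of the powers i and j gives the polynomial X^i - X^j directly.\<close>
proof (cases "inj_on (matrix_power A) {..DIM(complex^'n^'n)}")
  case False
  then obtain i j where ij: "i \<noteq> j" "matrix_power A i = matrix_power A j"
    unfolding inj_on_def by blast
  have "monom 1 i + monom (- 1) j \<noteq> (0 :: complex poly)"
  proof
    assume "monom 1 i + monom (- 1) j = (0 :: complex poly)"
    then have "coeff (monom 1 i + monom (- 1) j) i = (0 :: complex)" by simp
    then show False using ij by (simp add: coeff_monom)
  qed
  moreover have "poly_mult_vec A (monom 1 i + monom (- 1) j) x = 0" for x
    using ij by (simp add: poly_mult_vec_add poly_mult_vec_monom)
  ultimately show ?thesis by blast
next
  case inj: True
  let ?I = "{..DIM(complex^'n^'n)}"
  have "dependent (matrix_power A ` ?I)"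
    using inj by (intro dependent_biggerset) (simp add: card_image del: DIM_cart)
  then obtain u k where u: "(\<Sum>M\<in>matrix_power A ` ?I. u M *\<^sub>R M) = 0" and k: "k \<in> ?I" "u (matrix_power A k) \<noteq> 0"
    using real_vector.dependent_finite[of "matrix_power A ` ?I"] by blast
  define p where "p = (\<Sum>k\<in>?I. monom (complex_of_real (u (matrix_power A k))) k)"
  have "coeff p k = of_real (u (matrix_power A k))"
    using k by (simp add: p_def coeff_sum coeff_monom del: DIM_cart)
  then have "p \<noteq> 0" using k by auto
  moreover have "poly_mult_vec A p x = 0" for x
  proof -
    have "poly_mult_vec A p x = (\<Sum>k\<in>?I. (u (matrix_power A k) *\<^sub>R matrix_power A k) *v x)"
      by (simp add: p_def poly_mult_vec_sum poly_mult_vec_monom of_real_vector_scale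
          bounded_bilinear.scaleR_left[OF bounded_bilinear_matrix_vector_mult] del: DIM_cart)
    also have "\<dots> = (\<Sum>k\<in>?I. u (matrix_power A k) *\<^sub>R matrix_power A k) *v x"
      by (simp only: bounded_bilinear.sum_left[OF bounded_bilinear_matrix_vector_mult])
    also have "(\<Sum>k\<in>?I. u (matrix_power A k) *\<^sub>R matrix_power A k) = 0"
      using u by (simp add: sum.reindex[OF inj] o_def del: DIM_cart)
    finally show ?thesis by simp
  qed
  ultimately show ?thesis by blast
qed

abbreviation linear_factors :: "complex^'n^'n \<Rightarrow> complex list \<Rightarrow> complex^'n \<Rightarrow> complex^'n" where
  "linear_factors A \<equiv> foldr (\<lambda>l y. A *v y - l *s y)"

text \<open>By the fundamental theorem of algebra the annihilating polynomial splits, and its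
  nonzero leading coefficient can be cancelled. A list of factors permits induction on one factor at
  a time.\<close>

lemma ex_annihilating_linear_factors:
  fixes A :: "complex^'n^'n"
  shows "\<exists>L. \<forall>x. linear_factors A L x = 0"
proof -
  obtain p where p: "p \<noteq> 0" "\<And>x. poly_mult_vec A p x = 0" using ex_annihilating_poly[of A] by blast
  obtain L where L: "mset L = proots p" using ex_mset by blast
  have "p = smult (lead_coeff p) (prod_mset (image_mset (\<lambda>l. [:- l, 1:]) (mset L)))"
    using complex_poly_decompose_multiset[of p] L by simp
  also have "prod_mset (image_mset (\<lambda>l. [:- l, 1:]) (mset L)) = prod_list (map (\<lambda>l. [:- l, 1:]) L)"
    by (simp add: prod_mset_prod_list[symmetric])
  finally have pL: "p = smult (lead_coeff p) (prod_list (map (\<lambda>l. [:- l, 1:]) L))" .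
  have "poly_mult_vec A (prod_list (map (\<lambda>l. [:- l, 1:]) L)) x = linear_factors A L x" for x
  proof (induction L)
    case Nil
    show ?case by (simp add: one_pCons)
  next
    case (Cons l L)
    have "poly_mult_vec A [:- l, 1:] y = A *v y - l *s y" for y by (simp add: vec_eq_iff)
    then show ?case unfolding list.map prod_list.Cons poly_mult_vec_mult by (simp add: Cons.IH)
  qed
  then have "lead_coeff p *s linear_factors A L x = 0" for x
    using p(2)[of x] by (subst (asm) pL) (simp add: poly_mult_vec_smult)
  then have "linear_factors A L x = 0" for x
    using p(1) by (simp add: vec_eq_iff)
  then show ?thesis by blast
qed

section \<open>Eigenvalues and the growth of the exponential\<close>

lemma diff_mat_mult_vec: "(A - mat l) *v u = A *v u - l *s u" for A :: "complex^'n^'n"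
proof -
  have "mat l *v u = l *s u"
    by (simp add: vec_eq_iff matrix_vector_mult_def mat_def mult_delta_left)
  then show ?thesis by (simp add: matrix_vector_mult_diff_rdistrib)
qed

lemma spectrum_iff: "l \<in> spectrum A \<longleftrightarrow> (\<exists>u. u \<noteq> 0 \<and> A *v u - l *s u = 0)"
  unfolding spectrum_def mem_Collect_eq invertible_left_inverse matrix_left_invertible_ker diff_mat_mult_vec
  by blast

text \<open>On an eigenvector for l the annihilating product acts as multiplication by the product
  of all l - l', so l is one of the l'. Finiteness makes the \<open>Max\<close> in
  \<open>k_plus\<close> a genuine upper bound.\<close>

lemma finite_spectrum: "finite (spectrum (A :: complex^'n^'n))"
proof -
  obtain L where L: "\<And>x. linear_factors A L x = 0" using ex_annihilating_linear_factors[of A] by blast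
  have "spectrum A \<subseteq> set L"
  proof
    fix l assume "l \<in> spectrum A"
    then obtain u where u: "u \<noteq> 0" "A *v u = l *s u" by (auto simp: spectrum_iff)
    have "linear_factors A L u = prod_list (map (\<lambda>l'. l - l') L) *s u" for L
    proof (induction L)
      case (Cons a L)
      then show ?case by (simp add: vector_scalar_commute u(2)) (simp add: vec_eq_iff algebra_simps)
    qed simp
    with L[of u] u(1) have "prod_list (map (\<lambda>l'. l - l') L) = 0" by (metis vector_mul_eq_0)
    then show "l \<in> set L" by (auto simp: prod_list_zero_iff)
  qed
  then show ?thesis by (rule finite_subset) simp
qed

lemma Re_le_k_plus: "l \<in> spectrum A \<Longrightarrow> Re l \<le> k_plus A"
  unfolding k_plus_def by (rule Max_ge) (simp_all add: finite_spectrum)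

text \<open>A factor \<open>A - l\<close> with \<open>l\<close> outside the spectrum is injective and can be dropped; for an
  eigenvalue \<open>l\<close> the bound for \<open>y = A x - l x\<close> is integrated in
  \<open>(e\<^sup>-\<^sup>l\<^sup>t e\<^sup>t\<^sup>A x)' = e\<^sup>-\<^sup>l\<^sup>t e\<^sup>t\<^sup>A y\<close>.\<close>

lemma norm_mexp_mult_le_linear_factors:
  fixes A :: "complex^'n^'n"
  assumes \<kappa>: "\<kappa> > k_plus A" and "linear_factors A L x = 0"
  shows "\<exists>C. \<forall>t\<ge>0. norm (mexp (t *\<^sub>R A) *v x) \<le> C * exp (\<kappa> * t)"
  using assms(2)
proof (induction L arbitrary: x)
  case Nil
  then show ?case by (intro exI[of _ 0]) simp
next
  case (Cons l L)
  show ?case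
  proof (cases "l \<in> spectrum A")
    case False
    then have "linear_factors A L x = 0" using Cons.prems by (auto simp: spectrum_iff)
    then show ?thesis by (rule Cons.IH)
  next
    case True
    define y where "y = A *v x - l *s x"
    \<comment> \<open>A - l commutes with the remaining factors, so these annihilate y and the
      induction hypothesis applies to it.\<close>
    have "linear_factors A L (A *v x - l *s x) = A *v linear_factors A L x - l *s linear_factors A L x" for L x
    proof (induction L)
      case (Cons a L)
      then show ?case
        by (simp add: matrix_vector_mult_diff_distrib vector_scalar_commute)
    qed simp
    then have "linear_factors A L y = 0" using Cons.prems by (simp add: y_def)
    from Cons.IH[OF this] obtain C where C: "\<And>t. t \<ge> 0 \<Longrightarrow> norm (mexp (t *\<^sub>R A) *v y) \<le> C * exp (\<kappa> * t)"
      by blast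
    define a where "a = \<kappa> - Re l"
    have a: "a > 0" using Re_le_k_plus[OF True] \<kappa> by (simp add: a_def)
    have C0: "C \<ge> 0" using order_trans[OF norm_ge_zero C[of 0]] by simp
    define w where "w t = exp (- l * of_real t) *s (mexp (t *\<^sub>R A) *v x)" for t :: real
    have w: "(w has_vector_derivative exp (- l * of_real t) *s (mexp (t *\<^sub>R A) *v y)) (at t within S)" for t S
    proof -
      have "((\<lambda>t. exp (- l * of_real t)) has_vector_derivative exp (- l * of_real t) * - l) (at t within S)"
        by (rule has_vector_derivative_real_field) (auto intro!: derivative_eq_intros)
      note D = bounded_bilinear.has_vector_derivative[OF bounded_bilinear_vector_scale this
          mexp_mult_has_vector_derivative[of A x t S]]
      have y: "mexp (t *\<^sub>R A) *v y = A *v (mexp (t *\<^sub>R A) *v x) - l *s (mexp (t *\<^sub>R A) *v x)"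
        by (simp add: y_def vec.diff vector_scalar_commute matrix_vector_mul_assoc mexp_commute)
      have "exp (- l * of_real t) *s (mexp (t *\<^sub>R A) *v y) =
          exp (- l * of_real t) *s (A *v (mexp (t *\<^sub>R A) *v x)) +
          (exp (- l * of_real t) * - l) *s (mexp (t *\<^sub>R A) *v x)"
        unfolding y by (simp add: vec_eq_iff algebra_simps)
      with D show ?thesis unfolding w_def[abs_def] by (simp only:)
    qed
    \<comment> \<open>C / a comes from integrating C * exp (a t). For Re l = \<kappa> the integral
      would bring a factor t instead, hence the strict inequality for \<kappa>.\<close>
    have bound: "norm (w t) \<le> norm x + C / a * exp (a * t)" if "t \<ge> 0" for t
    proof (cases "t = 0")
      case True
      then show ?thesis using C0 a by (simp add: w_def mexp_0)
    next
      case False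
      with that have "t > 0" by simp
      have "norm (w t - w 0) \<le> C / a * exp (a * t) - C / a * exp (a * 0)"
      proof (rule differentiable_bound_general[OF \<open>t > 0\<close> _ _ w])
        show "continuous_on {0..t} w" by (intro continuous_at_imp_continuous_on ballI has_vector_derivative_continuous[OF w])
        show "continuous_on {0..t} (\<lambda>t. C / a * exp (a * t))" by (intro continuous_intros)
        fix s assume s: "0 < s" "s < t"
        show "((\<lambda>t. C / a * exp (a * t)) has_vector_derivative C * exp (a * s)) (at s)"
          unfolding has_real_derivative_iff_has_vector_derivative[symmetric] using a
          by (auto intro!: derivative_eq_intros)
        have "norm (exp (- l * of_real s) *s (mexp (s *\<^sub>R A) *v y)) \<le> exp (- Re l * s) * (C * exp (\<kappa> * s))"
          using C[of s] s by (simp add: norm_vector_scale norm_exp_eq_Re mult_left_mono)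
        also have "\<dots> = C * exp (a * s)" by (simp add: a_def exp_add[symmetric] algebra_simps)
        finally show "norm (exp (- l * of_real s) *s (mexp (s *\<^sub>R A) *v y)) \<le> C * exp (a * s)" .
      qed
      moreover have "w 0 = x" by (simp add: w_def mexp_0)
      moreover have "C / a \<ge> 0" using C0 a by simp
      ultimately show ?thesis using norm_triangle_sub[of "w t" x] by simp
    qed
    show ?thesis
    proof (intro exI[of _ "norm x + C / a"] allI impI)
      fix t :: real assume t: "t \<ge> 0"
      have "norm x * 1 \<le> norm x * exp (a * t)" using a t by (intro mult_left_mono) auto
      with bound[OF t] have "norm (w t) \<le> (norm x + C / a) * exp (a * t)" by (simp add: algebra_simps)
      moreover have "norm (w t) = exp (- Re l * t) * norm (mexp (t *\<^sub>R A) *v x)"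
        by (simp add: w_def norm_vector_scale norm_exp_eq_Re)
      ultimately have le: "exp (Re l * t) * (exp (- Re l * t) * norm (mexp (t *\<^sub>R A) *v x)) \<le>
          exp (Re l * t) * ((norm x + C / a) * exp (a * t))"
        by (intro mult_left_mono) auto
      have e1: "exp (Re l * t) * (exp (- Re l * t) * r) = r" for r
        by (simp add: mult.assoc[symmetric] exp_add[symmetric])
      have e2: "exp (Re l * t) * (r * exp (a * t)) = r * exp (\<kappa> * t)" for r
        by (simp add: a_def exp_add[symmetric] algebra_simps)
      from le show "norm (mexp (t *\<^sub>R A) *v x) \<le> (norm x + C / a) * exp (\<kappa> * t)" unfolding e1 e2 .
    qed
  qed
qed

text \<open>The constant for a single vector depends on that vector; expanding x in the standard
  basis turns finitely many such constants into one operator bound.\<close>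

lemma norm_mexp_mult_le:
  fixes A :: "complex^'n^'n"
  assumes \<kappa>: "\<kappa> > k_plus A"
  shows "\<exists>C\<ge>0. \<forall>t\<ge>0. \<forall>x. norm (mexp (t *\<^sub>R A) *v x) \<le> C * exp (\<kappa> * t) * norm x"
proof -
  obtain L where L: "\<And>x. linear_factors A L x = 0" using ex_annihilating_linear_factors[of A] by blast
  have "\<exists>C. \<forall>t\<ge>0. norm (mexp (t *\<^sub>R A) *v axis j 1) \<le> C * exp (\<kappa> * t)" for j
    by (rule norm_mexp_mult_le_linear_factors[OF \<kappa> L])
  then obtain C where C: "\<And>j t. t \<ge> 0 \<Longrightarrow> norm (mexp (t *\<^sub>R A) *v axis j 1) \<le> C j * exp (\<kappa> * t)"
    by metis
  have C0: "C j \<ge> 0" for j using order_trans[OF norm_ge_zero C[of 0 j]] by simp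
  show ?thesis
  proof (intro exI[of _ "\<Sum>j\<in>UNIV. C j"] conjI allI impI)
    show "(\<Sum>j\<in>UNIV. C j) \<ge> 0" using C0 by (intro sum_nonneg) auto
    fix t :: real and x :: "complex^'n" assume t: "t \<ge> 0"
    have "mexp (t *\<^sub>R A) *v x = mexp (t *\<^sub>R A) *v (\<Sum>j\<in>UNIV. x $ j *s axis j 1)"
      by (simp add: basis_expansion)
    also have "\<dots> = (\<Sum>j\<in>UNIV. x $ j *s (mexp (t *\<^sub>R A) *v axis j 1))"
      by (simp add: vec.sum vector_scalar_commute)
    finally have "norm (mexp (t *\<^sub>R A) *v x) \<le> (\<Sum>j\<in>UNIV. norm (x $ j) * norm (mexp (t *\<^sub>R A) *v axis j 1))"
      by (simp add: norm_vector_scale[symmetric] norm_sum)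
    also have "\<dots> \<le> (\<Sum>j\<in>UNIV. norm x * (C j * exp (\<kappa> * t)))"
      using C[OF t] by (intro sum_mono mult_mono Finite_Cartesian_Product.norm_nth_le) auto
    also have "\<dots> = (\<Sum>j\<in>UNIV. C j) * exp (\<kappa> * t) * norm x"
      by (simp add: sum_distrib_left sum_distrib_right mult_ac)
    finally show "norm (mexp (t *\<^sub>R A) *v x) \<le> (\<Sum>j\<in>UNIV. C j) * exp (\<kappa> * t) * norm x" .
  qed
qed

section \<open>Decay of the transition mapping\<close>

lemma AE_lebesgue_negligibleE:
  assumes "AE x in lebesgue. P x"
  shows "\<exists>N. negligible N \<and> (\<forall>x. x \<notin> N \<longrightarrow> P x)"
  using assms unfolding eventually_ae_filter by (auto simp: negligible_iff_null_sets)

lemma class_H_D: "h \<in> class_H A \<Longrightarrow> t \<ge> 0 \<Longrightarrow> (\<lambda>z. h z t) \<in> class_N A"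
  by (simp add: class_H_def)

text \<open>Gronwall's inequality in monotonicity form: where the trajectory is differentiable, E
  |v|^2 has derivative E' |v|^2 - 2 E Re <h(v,t), v>, which the lower bound for the class and the
  hypothesis on E' make nonpositive. The integrating factor E is left free because several are used;
  B makes it Lipschitz, so that the product is absolutely continuous.\<close>

lemma transition_weighted_norm_le:
  fixes A :: "complex^'n^'n"
  assumes A: "m_lower A > 0" and h: "h \<in> class_H A" and v: "transition_mapping h v"
    and z: "z \<in> ball 0 1" and s: "0 \<le> s" "s \<le> T"
    and E: "\<And>t. t \<in> {s..T} \<Longrightarrow> (E has_real_derivative E' t) (at t)"
    and E'_bound: "\<And>t. t \<in> {s..T} \<Longrightarrow> \<bar>E' t\<bar> \<le> B"
    and E_nonneg: "\<And>t. t \<in> {s..T} \<Longrightarrow> 0 \<le> E t"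
    and E'_le: "\<And>t. t \<in> {s..T} \<Longrightarrow>
      E' t \<le> 2 * m_lower A * ((1 - norm (v z s t)) / (1 + norm (v z s t))) * E t"
  shows "E T * (norm (v z s T))\<^sup>2 \<le> E s * (norm z)\<^sup>2"
proof -
  define u where "u = v z s"
  have u_ball: "norm (u t) < 1" if "t \<ge> s" for t
    using v z s that unfolding transition_mapping_def u_def by auto
  have us: "u s = z" using v z s unfolding transition_mapping_def u_def by auto
  have ac: "unif_abs_cont_on {z} {s..T} (\<lambda>w. v w s)"
    using v z s unfolding transition_mapping_def by auto
  have "AE t in lebesgue. t \<ge> s \<longrightarrow> (u has_vector_derivative - h (u t) t) (at t)"
    using v z s unfolding transition_mapping_def u_def by auto
  from AE_lebesgue_negligibleE[OF this] obtain N where N: "negligible N"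
    and du: "\<And>t. t \<notin> N \<Longrightarrow> t \<ge> s \<Longrightarrow> (u has_vector_derivative - h (u t) t) (at t)" by blast
  have B: "B \<ge> 0" using E'_bound[of s] s by auto
  have E_lip: "\<bar>E y - E x\<bar> \<le> B * (y - x)" if "x \<in> {s..T}" "y \<in> {s..T}" "x \<le> y" for x y
  proof -
    have "norm (E y - E x) \<le> B * norm (y - x)"
    proof (rule field_differentiable_bound[of "{s..T}"])
      fix t assume "t \<in> {s..T}"
      then show "(E has_field_derivative E' t) (at t within {s..T})" "norm (E' t) \<le> B"
        using E E'_bound by (auto intro: has_field_derivative_at_within)
    qed (use that in auto)
    then show ?thesis using that by simp
  qed
  \<comment> \<open>E is at most E s + B (T - s) on the interval, the square of the norm has
    Lipschitz constant 2 in the unit ball, and the last B accounts for the variation of E.\<close>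
  define L where "L = 2 * (E s + B * (T - s)) + B"
  have L0: "L \<ge> 0" using B s E_nonneg[of s] by (simp add: L_def)
  have "E T * (norm (u T))\<^sup>2 - E s * (norm (u s))\<^sup>2 \<le> 0 * (T - s)"
  proof (rule abs_cont_increment_le[where g="\<lambda>_ t. E t * (norm (u t))\<^sup>2" and z = z, OF _ s(2) N])
    show "unif_abs_cont_on {z} {s..T} (\<lambda>_ t. E t * (norm (u t))\<^sup>2)"
    proof (rule unif_abs_cont_on_dominated[OF ac _ L0])
      fix x y assume xy: "x \<in> {s..T}" "y \<in> {s..T}" "x \<le> y"
      have nxy: "norm (u x) < 1" "norm (u y) < 1" using u_ball xy by auto
      have "\<bar>(norm (u y))\<^sup>2 - (norm (u x))\<^sup>2\<bar> = \<bar>norm (u y) - norm (u x)\<bar> * (norm (u y) + norm (u x))"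
        by (simp add: power2_eq_square square_diff_square_factored abs_mult mult.commute)
      also have "\<dots> \<le> norm (u y - u x) * 2"
        using nxy by (intro mult_mono norm_triangle_ineq3) auto
      finally have 1: "\<bar>(norm (u y))\<^sup>2 - (norm (u x))\<^sup>2\<bar> \<le> norm (u y - u x) * 2" .
      have "E y \<le> E s + B * (y - s)" using E_lip[of s y] xy s by auto
      also have "\<dots> \<le> E s + B * (T - s)" using B xy by (intro add_left_mono mult_left_mono) auto
      finally have "\<bar>E y\<bar> \<le> E s + B * (T - s)" using E_nonneg[OF xy(2)] by simp
      from mult_mono[OF this 1] have
        2: "\<bar>E y * ((norm (u y))\<^sup>2 - (norm (u x))\<^sup>2)\<bar> \<le> (E s + B * (T - s)) * (norm (u y - u x) * 2)"
        using B s E_nonneg[of s] by (simp add: abs_mult)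
      have 3: "\<bar>(E y - E x) * (norm (u x))\<^sup>2\<bar> \<le> B * (y - x) * 1"
        unfolding abs_mult using E_lip[OF xy] nxy xy B by (intro mult_mono) (auto simp: power_le_one)
      have "norm (E y * (norm (u y))\<^sup>2 - E x * (norm (u x))\<^sup>2) =
          \<bar>E y * ((norm (u y))\<^sup>2 - (norm (u x))\<^sup>2) + (E y - E x) * (norm (u x))\<^sup>2\<bar>"
        by (simp add: algebra_simps)
      also have "\<dots> \<le> (E s + B * (T - s)) * (norm (u y - u x) * 2) + B * (y - x) * 1"
        using 2 3 by linarith
      also have "\<dots> \<le> L * norm (u y - u x) + L * (y - x)"
      proof -
        define P where "P = E s + B * (T - s)"
        have "P \<ge> 0" using B s E_nonneg[of s] by (simp add: P_def)
        then have "0 \<le> B * norm (u y - u x) + 2 * P * (y - x)" using B xy by simp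
        then show ?thesis unfolding L_def P_def[symmetric] by (simp add: algebra_simps)
      qed
      finally show "norm (E y * (norm (u y))\<^sup>2 - E x * (norm (u x))\<^sup>2)
          \<le> L * norm (v z s y - v z s x) + L * (y - x)" by (simp add: u_def)
    qed
    fix t assume t: "t \<in> {s..T} - N"
    then have ts: "t \<ge> s" "t \<ge> 0" "t \<notin> N" and tT: "t \<in> {s..T}" using s by auto
    define \<rho> where "\<rho> = norm (u t)"
    have \<rho>: "0 \<le> \<rho>" "\<rho> < 1" using u_ball[OF ts(1)] by (auto simp: \<rho>_def)
    have d: "(u has_derivative (\<lambda>x. x *\<^sub>R (- h (u t) t))) (at t)"
      using du[OF ts(3,1)] by (simp add: has_vector_derivative_def)
    have "((\<lambda>t. E t * (u t \<bullet> u t)) has_derivative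
        (\<lambda>x. E t * (u t \<bullet> (x *\<^sub>R (- h (u t) t)) + (x *\<^sub>R (- h (u t) t)) \<bullet> u t) + E' t * x * (u t \<bullet> u t))) (at t)"
      using E[OF tT] by (intro has_derivative_mult has_derivative_inner d) (simp add: has_field_derivative_def)
    then have "((\<lambda>t. E t * (norm (u t))\<^sup>2) has_real_derivative
        (E' t * \<rho>\<^sup>2 - 2 * E t * (h (u t) t \<bullet> u t))) (at t)"
      unfolding has_field_derivative_def power2_norm_eq_inner
      by (rule has_derivative_eq_rhs)
         (simp add: fun_eq_iff \<rho>_def power2_norm_eq_inner inner_commute algebra_simps)
    moreover have "E' t * \<rho>\<^sup>2 - 2 * E t * (h (u t) t \<bullet> u t) \<le> 0"
    proof -
      have "m_lower A * \<rho>\<^sup>2 * (1 - \<rho>) / (1 + \<rho>) \<le> h (u t) t \<bullet> u t"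
        using class_N_bounds(1)[OF class_H_D[OF h ts(2)] A u_ball[OF ts(1)]]
        by (simp add: Re_cinner \<rho>_def)
      then have "2 * E t * (m_lower A * \<rho>\<^sup>2 * (1 - \<rho>) / (1 + \<rho>)) \<le> 2 * E t * (h (u t) t \<bullet> u t)"
        using E_nonneg[OF tT] by (intro mult_left_mono) auto
      moreover have "E' t * \<rho>\<^sup>2 \<le> 2 * m_lower A * ((1 - \<rho>) / (1 + \<rho>)) * E t * \<rho>\<^sup>2"
        using E'_le[OF tT] by (intro mult_right_mono) (auto simp: \<rho>_def u_def)
      moreover have "2 * E t * (m_lower A * \<rho>\<^sup>2 * (1 - \<rho>) / (1 + \<rho>)) =
          2 * m_lower A * ((1 - \<rho>) / (1 + \<rho>)) * E t * \<rho>\<^sup>2" by simp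
      ultimately show ?thesis by linarith
    qed
    ultimately show "\<exists>D. ((\<lambda>t. E t * (norm (u t))\<^sup>2) has_real_derivative D) (at t within {s..T}) \<and> D \<le> 0"
      by (blast intro: has_field_derivative_at_within)
  qed simp
  then show ?thesis by (simp add: us u_def[symmetric])
qed

text \<open>The weight E = 1. Trajectories stay in the closed ball where they start, which makes
  estimates on a fixed compact ball available for all times.\<close>

lemma transition_norm_le:
  fixes A :: "complex^'n^'n"
  assumes "m_lower A > 0" "h \<in> class_H A" "transition_mapping h v" "z \<in> ball 0 1" "0 \<le> s" "s \<le> t"
  shows "norm (v z s t) \<le> norm z"
proof -
  have "1 * (norm (v z s t))\<^sup>2 \<le> 1 * (norm z)\<^sup>2"
  proof (rule transition_weighted_norm_le[OF assms, where E="\<lambda>_. 1" and E'="\<lambda>_. 0" and B=0])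
    fix \<tau> assume "\<tau> \<in> {s..t}"
    then have "norm (v z s \<tau>) < 1" using assms unfolding transition_mapping_def by auto
    then show "0 \<le> 2 * m_lower A * ((1 - norm (v z s \<tau>)) / (1 + norm (v z s \<tau>))) * 1"
      using assms(1) by simp
  qed auto
  then have "(norm (v z s t))\<^sup>2 \<le> (norm z)\<^sup>2" by simp
  then show ?thesis by (rule power2_le_imp_le) simp
qed

text \<open>Two steps: Gronwall with the crude rate \<open>c = m (1 - r) / (1 + r)\<close> first; the resulting
  exponential decay makes the deviation \<open>2\<parallel>v\<parallel>\<close> of \<open>(1 - \<parallel>v\<parallel>) / (1 + \<parallel>v\<parallel>)\<close> from \<open>1\<close> integrable in time,
  so that the sharp rate \<open>m\<close> is reached up to a constant factor.\<close>

lemma transition_exponential_decay: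
  fixes A :: "complex^'n^'n"
  assumes A: "m_lower A > 0" and h: "h \<in> class_H A" and v: "transition_mapping h v"
    and r: "0 \<le> r" "r < 1" and z: "norm z \<le> r" and s: "0 \<le> s" "s \<le> T"
  shows "norm (v z s T) \<le> exp (2 * (1 + r) / (1 - r)) * exp (- m_lower A * (T - s))"
proof -
  define m where "m = m_lower A"
  define c where "c = m * ((1 - r) / (1 + r))"
  have m: "m > 0" using A by (simp add: m_def)
  have c: "c > 0" using m r by (simp add: c_def)
  have zb: "z \<in> ball 0 1" using z r by simp
  have 1: "norm (v z s t) \<le> r" if "t \<ge> s" for t
    using transition_norm_le[OF A h v zb s(1) that] z by simp
  have 2: "norm (v z s t) \<le> exp (- c * (t - s))" if t: "t \<ge> s" for t
  proof -
    have "exp (2 * c * (t - s)) * (norm (v z s t))\<^sup>2 \<le> exp (2 * c * (s - s)) * (norm z)\<^sup>2"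
    proof (rule transition_weighted_norm_le[OF A h v zb s(1) t, where E="\<lambda>t. exp (2 * c * (t - s))"
          and E'="\<lambda>t. 2 * c * exp (2 * c * (t - s))" and B = "2 * c * exp (2 * c * (t - s))"])
      fix \<tau> assume \<tau>: "\<tau> \<in> {s..t}"
      show "((\<lambda>t. exp (2 * c * (t - s))) has_real_derivative 2 * c * exp (2 * c * (\<tau> - s))) (at \<tau>)"
        by (auto intro!: derivative_eq_intros)
      show "\<bar>2 * c * exp (2 * c * (\<tau> - s))\<bar> \<le> 2 * c * exp (2 * c * (t - s))"
        using c \<tau> by (simp add: abs_mult)
      have "(1 - r) / (1 + r) \<le> (1 - norm (v z s \<tau>)) / (1 + norm (v z s \<tau>))"
        using 1[of \<tau>] \<tau> r by (intro frac_le) (auto intro: add_pos_nonneg)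
      then have "c \<le> m * ((1 - norm (v z s \<tau>)) / (1 + norm (v z s \<tau>)))"
        unfolding c_def using m by (intro mult_left_mono) auto
      then show "2 * c * exp (2 * c * (\<tau> - s)) \<le>
          2 * m_lower A * ((1 - norm (v z s \<tau>)) / (1 + norm (v z s \<tau>))) * exp (2 * c * (\<tau> - s))"
        by (intro mult_right_mono) (auto simp: m_def)
    qed simp
    also have "\<dots> \<le> 1" using z r by (simp add: power_le_one)
    finally have "(norm (v z s t))\<^sup>2 \<le> inverse (exp (2 * c * (t - s)))"
      by (simp only: inverse_eq_divide pos_le_divide_eq exp_gt_zero mult.commute)
    also have "\<dots> = (exp (- c * (t - s)))\<^sup>2"
      by (simp add: exp_minus[symmetric] power2_eq_square exp_add[symmetric] algebra_simps)
    finally have "(norm (v z s t))\<^sup>2 \<le> (exp (- c * (t - s)))\<^sup>2" .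
    then show ?thesis by (rule power2_le_imp_le) simp
  qed
  \<comment> \<open>Obtained by integrating (log E)' = 2 m (1 - 2 exp (- c (t - s))), the growth
    rate permitted by the crude decay just proved.\<close>
  define E where "E t = exp (2 * m * (t - s) + 4 * m / c * exp (- c * (t - s)))" for t
  define E' where "E' t = E t * (2 * m - 4 * m * exp (- c * (t - s)))" for t
  have "E T * (norm (v z s T))\<^sup>2 \<le> E s * (norm z)\<^sup>2"
  proof (rule transition_weighted_norm_le[OF A h v zb s, where E' = E'
        and B = "exp (2 * m * (T - s) + 4 * m / c) * (6 * m)"])
    fix t assume t: "t \<in> {s..T}"
    show "(E has_real_derivative E' t) (at t)"
      unfolding E_def[abs_def] E'_def using c by (auto intro!: derivative_eq_intros simp: algebra_simps)
    show "0 \<le> E t" by (simp add: E_def)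
    have e1: "exp (- c * (t - s)) \<le> 1" using c t by simp
    have "4 * m / c * exp (- c * (t - s)) \<le> 4 * m / c * 1"
      using m c e1 by (intro mult_left_mono) auto
    moreover have "2 * m * (t - s) \<le> 2 * m * (T - s)" using m t by simp
    ultimately have "E t \<le> exp (2 * m * (T - s) + 4 * m / c)"
      unfolding E_def exp_le_cancel_iff by linarith
    moreover have "\<bar>2 * m - 4 * m * exp (- c * (t - s))\<bar> \<le> 6 * m"
    proof -
      have "4 * m * exp (- c * (t - s)) \<le> 4 * m * 1" using m e1 by (intro mult_left_mono) auto
      moreover have "0 \<le> 4 * m * exp (- c * (t - s))" using m by simp
      ultimately show ?thesis using m by linarith
    qed
    ultimately show "\<bar>E' t\<bar> \<le> exp (2 * m * (T - s) + 4 * m / c) * (6 * m)"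
      unfolding E'_def abs_mult using \<open>0 \<le> E t\<close> by (intro mult_mono) auto
    define \<rho> where "\<rho> = norm (v z s t)"
    \<comment> \<open>The two sides differ by 2 \<rho>^2 / (1 + \<rho>).\<close>
    have "1 - 2 * \<rho> \<le> (1 - \<rho>) / (1 + \<rho>)"
      using norm_ge_zero[of "v z s t"] by (simp add: \<rho>_def[symmetric] field_simps)
    moreover have "\<rho> \<le> exp (- c * (t - s))" using 2[of t] t by (simp add: \<rho>_def)
    ultimately have "1 - 2 * exp (- c * (t - s)) \<le> (1 - \<rho>) / (1 + \<rho>)" by linarith
    then have "2 * m * (1 - 2 * exp (- c * (t - s))) \<le> 2 * m * ((1 - \<rho>) / (1 + \<rho>))"
      using m by (intro mult_left_mono) auto
    then have "(2 * m - 4 * m * exp (- c * (t - s))) * E t \<le> 2 * m * ((1 - \<rho>) / (1 + \<rho>)) * E t"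
      using \<open>0 \<le> E t\<close> by (intro mult_right_mono) (simp_all add: algebra_simps)
    then show "E' t \<le> 2 * m_lower A * ((1 - norm (v z s t)) / (1 + norm (v z s t))) * E t"
      by (simp add: E'_def \<rho>_def m_def mult_ac)
  qed
  \<comment> \<open>E s equals exp (4 m / c), while E T is at least exp (2 m (T - s)): the
    correction costs only a constant.\<close>
  also have "\<dots> \<le> exp (4 * m / c) * 1"
    using z r by (intro mult_mono) (auto simp: E_def power_le_one)
  finally have "E T * (norm (v z s T))\<^sup>2 \<le> exp (4 * m / c)" by simp
  moreover have "exp (2 * m * (T - s)) * (norm (v z s T))\<^sup>2 \<le> E T * (norm (v z s T))\<^sup>2"
    using m c by (intro mult_right_mono) (auto simp: E_def)
  ultimately have "exp (2 * m * (T - s)) * (norm (v z s T))\<^sup>2 \<le> exp (4 * m / c)" by linarith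
  then have "exp (- (2 * m * (T - s))) * (exp (2 * m * (T - s)) * (norm (v z s T))\<^sup>2) \<le>
      exp (- (2 * m * (T - s))) * exp (4 * m / c)"
    by (intro mult_left_mono) auto
  also have "\<dots> = (exp (2 * m / c) * exp (- m * (T - s)))\<^sup>2"
    by (simp add: power2_eq_square exp_add[symmetric] algebra_simps)
  finally have "(norm (v z s T))\<^sup>2 \<le> (exp (2 * m / c) * exp (- m * (T - s)))\<^sup>2"
    by (simp add: mult.assoc[symmetric] exp_add[symmetric])
  then have "norm (v z s T) \<le> exp (2 * m / c) * exp (- m * (T - s))"
    by (rule power2_le_imp_le) simp
  moreover have "2 * m / c = 2 * (1 + r) / (1 - r)" using m r by (simp add: c_def field_simps)
  ultimately show ?thesis by (simp add: m_def)
qed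

section \<open>Invariance of solutions along the transition mapping\<close>

text \<open>Applying e^{tA} to the polynomially bounded e^{-tA} f gives a bound continuous in t,
  hence bounded on [0,T]. Any exponent above k_+(A) would do in place of
  \<open>k_plus A + 1\<close>.\<close>

lemma loewner_solution_locally_bounded:
  fixes A :: "complex^'n^'n"
  assumes pb: "polynomially_bounded A f" and R: "R < 1" and T: "0 \<le> T"
  shows "\<exists>B\<ge>0. \<forall>z\<in>cball 0 R. \<forall>t\<in>{0..T}. norm (f z t) \<le> B"
proof -
  have "compact (cball 0 R :: (complex^'n) set)" "cball 0 R \<subseteq> (ball 0 1 :: (complex^'n) set)"
    using R by auto
  then obtain c P where cP: "\<And>z t. z \<in> cball 0 R \<Longrightarrow> t \<ge> 0 \<Longrightarrow>
      norm (mexp ((- t) *\<^sub>R A) *v f z t) \<le> c * poly P t"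
    using pb unfolding polynomially_bounded_def by meson
  obtain C where C: "C \<ge> 0" "\<And>t x. t \<ge> 0 \<Longrightarrow>
      norm (mexp (t *\<^sub>R A) *v x) \<le> C * exp ((k_plus A + 1) * t) * norm x"
    using norm_mexp_mult_le[of A "k_plus A + 1"] by auto
  have "continuous_on {0..T} (\<lambda>t. C * exp ((k_plus A + 1) * t) * (c * poly P t))"
    by (intro continuous_intros)
  then have "bounded ((\<lambda>t. C * exp ((k_plus A + 1) * t) * (c * poly P t)) ` {0..T})"
    by (intro compact_imp_bounded compact_continuous_image) auto
  then obtain B where B: "\<forall>t\<in>{0..T}. \<bar>C * exp ((k_plus A + 1) * t) * (c * poly P t)\<bar> \<le> B"
    unfolding bounded_iff by auto
  have "norm (f z t) \<le> B" if z: "z \<in> cball 0 R" and t: "t \<in> {0..T}" for z t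
  proof -
    have "f z t = mexp (t *\<^sub>R A) *v (mexp ((- t) *\<^sub>R A) *v f z t)"
      using mexp_uminus_mult[of "- t" A "f z t"] by simp
    then have "norm (f z t) \<le> C * exp ((k_plus A + 1) * t) * norm (mexp ((- t) *\<^sub>R A) *v f z t)"
      using C(2)[of t "mexp ((- t) *\<^sub>R A) *v f z t"] t by simp
    also have "\<dots> \<le> C * exp ((k_plus A + 1) * t) * (c * poly P t)"
      using cP[OF z] t C(1) by (intro mult_left_mono) auto
    also have "\<dots> \<le> B" using B t by fastforce
    finally show ?thesis .
  qed
  moreover have "B \<ge> 0" using order_trans[OF abs_ge_zero bspec[OF B, of 0]] T by simp
  ultimately show ?thesis by blast
qed

text \<open>The time derivative Df h is bounded almost everywhere, uniformly in z: Df by Cauchy's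
  estimate and h by the bound common to the class. Absolute continuity turns this into a Lipschitz
  bound, needed for f along a moving point to be absolutely continuous.\<close>

lemma loewner_solution_lipschitz_time:
  fixes A :: "complex^'n^'n"
  assumes A: "m_lower A > 0" and h: "h \<in> class_H A" and f: "loewner_solution A h f"
    and pb: "polynomially_bounded A f" and r: "0 \<le> r" "r < 1" and T: "0 \<le> T"
  shows "\<exists>L\<ge>0. \<forall>z\<in>cball 0 r. \<forall>x y. 0 \<le> x \<and> x \<le> y \<and> y \<le> T \<longrightarrow> norm (f z y - f z x) \<le> L * (y - x)"
proof -
  define R where "R = (1 + r) / 2"
  have R: "r < R" "R < 1" using r by (auto simp: R_def)
  obtain B where B: "B \<ge> 0" "\<And>z t. z \<in> cball 0 R \<Longrightarrow> t \<in> {0..T} \<Longrightarrow> norm (f z t) \<le> B"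
    using loewner_solution_locally_bounded[OF pb R(2) T] by blast
  obtain H where H: "H \<ge> 0" and H': "\<forall>g\<in>class_N A. \<forall>z. norm z \<le> r \<longrightarrow> norm (g z) \<le> H"
    using class_N_locally_bounded[OF A r] by blast
  have "AE t in lebesgue. t \<ge> 0 \<longrightarrow> (\<forall>z\<in>ball 0 1. ((\<lambda>\<tau>. f z \<tau>) has_vector_derivative
            frechet_derivative (\<lambda>w. f w t) (at z) (h z t)) (at t))"
    using f by (simp add: loewner_solution_def)
  from AE_lebesgue_negligibleE[OF this] obtain N where N: "negligible N" and
    df: "\<And>t z. t \<notin> N \<Longrightarrow> t \<ge> 0 \<Longrightarrow> z \<in> ball 0 1 \<Longrightarrow> (f z has_vector_derivative
            frechet_derivative (\<lambda>w. f w t) (at z) (h z t)) (at t)" by blast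
  show ?thesis
  proof (intro exI[of _ "B / (R - r) * H"] conjI ballI allI impI)
    show "0 \<le> B / (R - r) * H" using B H R by simp
    fix z :: "complex^'n" and x y assume z: "z \<in> cball 0 r" and xy: "0 \<le> x \<and> x \<le> y \<and> y \<le> T"
    have zb: "z \<in> ball 0 1" using z r by simp
    have "unif_abs_cont_on {z} {0..T} f"
      using f zb T unfolding loewner_solution_def by simp
    then have ac: "unif_abs_cont_on {z} {x..y} f"
      by (rule unif_abs_cont_on_subset) (use xy in auto)
    show "norm (f z y - f z x) \<le> B / (R - r) * H * (y - x)"
    proof (rule abs_cont_norm_increment_le[OF ac _ N])
      fix t assume t: "t \<in> {x..y} - N"
      then have t0: "t \<ge> 0" "t \<notin> N" "t \<in> {0..T}" using xy by auto
      have hol: "holomorphic_map_on (\<lambda>w. f w t) (ball 0 1)"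
        using f t0 by (simp add: loewner_solution_def)
      then obtain M where M: "((\<lambda>w. f w t) has_derivative (\<lambda>w. M *v w)) (at z)"
        using zb unfolding holomorphic_map_on_def by blast
      have sub: "cball z (R - r) \<subseteq> cball 0 R"
      proof
        fix y assume "y \<in> cball z (R - r)"
        then have "dist z y \<le> R - r" "dist 0 z \<le> r" using z by auto
        then have "dist 0 y \<le> R" using dist_triangle[of 0 y z] by linarith
        then show "y \<in> cball 0 R" by simp
      qed
      have "norm (M *v h z t) \<le> B / (R - r) * norm (h z t)"
      proof (rule holomorphic_map_derivative_le[OF hol _ _ _ M])
        show "cball z (R - r) \<subseteq> ball 0 1" using sub R by (auto simp: subset_iff)
        show "norm (f w t) \<le> B" if "w \<in> cball z (R - r)" for w using B(2) sub that t0 by blast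
      qed (use R in simp)
      also have "\<dots> \<le> B / (R - r) * H"
        using bspec[OF H' class_H_D[OF h t0(1)]] z B R by (intro mult_left_mono) auto
      finally have "norm (M *v h z t) \<le> B / (R - r) * H" .
      moreover have "frechet_derivative (\<lambda>w. f w t) (at z) = (\<lambda>w. M *v w)"
        using frechet_derivative_at[OF M] by simp
      ultimately show "\<exists>D. (f z has_vector_derivative D) (at t within {x..y}) \<and> norm D \<le> B / (R - r) * H"
        using df[OF t0(2,1) zb] by (auto intro: has_vector_derivative_at_within)
    qed (use xy B H R in auto)
  qed
qed

lemma holomorphic_map_on_diff:
  assumes "holomorphic_map_on f S" "holomorphic_map_on g S"
  shows "holomorphic_map_on (\<lambda>z. f z - g z) S"
  unfolding holomorphic_map_on_def
proof
  fix z assume z: "z \<in> S"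
  obtain M M' where "(f has_derivative (\<lambda>w. M *v w)) (at z)" "(g has_derivative (\<lambda>w. M' *v w)) (at z)"
    using assms z unfolding holomorphic_map_on_def by blast
  from has_derivative_diff[OF this]
  have "((\<lambda>z. f z - g z) has_derivative (\<lambda>w. (M - M') *v w)) (at z)"
    by (simp add: matrix_vector_mult_diff_rdistrib)
  then show "\<exists>M. ((\<lambda>z. f z - g z) has_derivative (\<lambda>w. M *v w)) (at z)" by blast
qed

lemma unif_abs_cont_on_imp_small_increment:
  assumes ac: "unif_abs_cont_on K {a..b} g" and e: "e > 0"
  shows "\<exists>d>0. \<forall>x\<in>{a..b}. \<forall>y\<in>{a..b}. \<bar>y - x\<bar> < d \<longrightarrow> (\<forall>z\<in>K. norm (g z y - g z x) < e)"
proof -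
  from ac e obtain d where "d > 0" and d: "\<forall>(N::nat) l r. (\<forall>i<N. l i \<le> r i \<and> {l i..r i} \<subseteq> {a..b}) \<and>
      (\<forall>i<N. \<forall>j<N. i \<noteq> j \<longrightarrow> {l i<..<r i} \<inter> {l j<..<r j} = {}) \<and>
      (\<Sum>i<N. r i - l i) < d \<longrightarrow> (\<forall>x\<in>K. (\<Sum>i<N. norm (g x (r i) - g x (l i))) < e)"
    unfolding unif_abs_cont_on_def by blast
  have *: "\<forall>z\<in>K. norm (g z y - g z x) < e" if "x \<in> {a..b}" "y \<in> {a..b}" "x \<le> y" "y - x < d" for x y
    using d[THEN spec[of _ 1], THEN spec[of _ "\<lambda>_. x"], THEN spec[of _ "\<lambda>_. y"]] that by simp
  show ?thesis
  proof (intro exI[of _ d] conjI ballI impI)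
    fix x y z assume xy: "x \<in> {a..b}" "y \<in> {a..b}" "\<bar>y - x\<bar> < d" and z: "z \<in> K"
    show "norm (g z y - g z x) < e"
    proof (cases "x \<le> y")
      case True then show ?thesis using *[of x y] xy z by auto
    next
      case False then show ?thesis using *[of y x] xy z by (auto simp: norm_minus_commute)
    qed
  qed (fact \<open>d > 0\<close>)
qed

text \<open>The error term of the chain rule. For \<tau> near t the map f(.,\<tau>) - f(.,t) is
  uniformly small on the larger ball, so by Cauchy's estimate it has a small Lipschitz constant on
  the smaller one; as u moves at most linearly, the mixed difference is o(|\<tau> - t|).\<close>

lemma has_vector_derivative_mixed_difference_zero:
  fixes f :: "complex^'n \<Rightarrow> real \<Rightarrow> complex^'n"
  assumes hol: "\<And>t. t \<in> {a..b} \<Longrightarrow> holomorphic_map_on (\<lambda>z. f z t) (ball 0 1)"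
    and ac: "unif_abs_cont_on (cball 0 R) {a..b} f" and R: "r < R" "R < 1"
    and u: "\<And>t. t \<in> {a..b} \<Longrightarrow> norm (u t) \<le> r"
    and du: "(u has_vector_derivative D) (at t within {a..b})" and t: "t \<in> {a..b}"
  shows "((\<lambda>\<tau>. f (u \<tau>) \<tau> - f (u \<tau>) t - (f (u t) \<tau> - f (u t) t)) has_vector_derivative 0) (at t within {a..b})"
  unfolding has_vector_derivative_def has_derivative_within_alt
proof (intro conjI allI impI)
  fix e :: real assume e: "e > 0"
  \<comment> \<open>Chosen so that \<eta> / (R - r), the Lipschitz constant, times the speed bound
    norm D + 1 of u equals e.\<close>
  define \<eta> where "\<eta> = e * (R - r) / (norm D + 1)"
  have D: "norm D + 1 > 0" by (simp add: add_nonneg_pos)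
  have \<eta>: "\<eta> > 0" using e R D by (simp add: \<eta>_def)
  obtain d1 where d1: "d1 > 0" "\<And>y z. y \<in> {a..b} \<Longrightarrow> \<bar>y - t\<bar> < d1 \<Longrightarrow> z \<in> cball 0 R \<Longrightarrow>
      norm (f z y - f z t) < \<eta>"
    using unif_abs_cont_on_imp_small_increment[OF ac \<eta>] t by blast
  from du obtain d2 where d2: "d2 > 0" "\<And>y. y \<in> {a..b} \<Longrightarrow> norm (y - t) < d2 \<Longrightarrow>
      norm (u y - u t - (y - t) *\<^sub>R D) \<le> 1 * norm (y - t)"
    unfolding has_vector_derivative_def has_derivative_within_alt by (meson zero_less_one)
  show "\<exists>d>0. \<forall>y\<in>{a..b}. norm (y - t) < d \<longrightarrow>
      norm (f (u y) y - f (u y) t - (f (u t) y - f (u t) t) -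
        (f (u t) t - f (u t) t - (f (u t) t - f (u t) t)) - (y - t) *\<^sub>R 0) \<le> e * norm (y - t)"
  proof (intro exI[of _ "min d1 d2"] conjI ballI impI)
    fix y assume y: "y \<in> {a..b}" "norm (y - t) < min d1 d2"
    have "norm (u y - u t) \<le> norm (u y - u t - (y - t) *\<^sub>R D) + norm ((y - t) *\<^sub>R D)"
      using norm_triangle_ineq[of "u y - u t - (y - t) *\<^sub>R D" "(y - t) *\<^sub>R D"] by simp
    also have "\<dots> \<le> 1 * norm (y - t) + \<bar>y - t\<bar> * norm D"
      using y(2) by (intro add_mono d2(2)[OF y(1)]) auto
    also have "\<dots> = \<bar>y - t\<bar> * (norm D + 1)" by (simp add: algebra_simps)
    finally have uy: "norm (u y - u t) \<le> \<bar>y - t\<bar> * (norm D + 1)" .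
    have "norm ((f (u y) y - f (u y) t) - (f (u t) y - f (u t) t)) \<le> \<eta> / (R - r) * norm (u y - u t)"
    proof (rule holomorphic_map_lipschitz[OF holomorphic_map_on_diff[OF hol[OF y(1)] hol[OF t]] _ R(1)])
      show "norm (f z y - f z t) \<le> \<eta>" if "z \<in> cball 0 R" for z
        using d1(2)[OF y(1) _ that] y(2) by simp
    qed (use R u y t in auto)
    also have "\<dots> \<le> \<eta> / (R - r) * (\<bar>y - t\<bar> * (norm D + 1))"
      using uy \<eta> R by (intro mult_left_mono) auto
    also have "\<dots> = e * \<bar>y - t\<bar>"
      using D R by (simp add: \<eta>_def)
    finally show "norm (f (u y) y - f (u y) t - (f (u t) y - f (u t) t) -
        (f (u t) t - f (u t) t - (f (u t) t - f (u t) t)) - (y - t) *\<^sub>R 0) \<le> e * norm (y - t)" by simp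
  qed (use d1 d2 in simp)
qed (simp add: bounded_linear_zero)

lemma loewner_solution_transition:
  fixes A :: "complex^'n^'n"
  assumes A: "m_lower A > 0" and h: "h \<in> class_H A" and v: "transition_mapping h v"
    and f: "loewner_solution A h f" and pb: "polynomially_bounded A f"
    and z: "z \<in> ball 0 1" and s: "0 \<le> s" "s \<le> T"
  shows "f (v z s T) T = f z s"
proof -
  define u where "u = v z s"
  define r where "r = norm z"
  define R where "R = (1 + r) / 2"
  have r: "0 \<le> r" "r < 1" using z by (auto simp: r_def)
  have R: "r < R" "R < 1" using r by (auto simp: R_def)
  have u: "norm (u t) \<le> r" if "t \<in> {s..T}" for t
    using transition_norm_le[OF A h v z s(1)] that by (simp add: u_def r_def)
  have us: "u s = z" using v z s unfolding transition_mapping_def u_def by auto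
  have acv: "unif_abs_cont_on {z} {s..T} (\<lambda>w. v w s)"
    using v z s unfolding transition_mapping_def by auto
  have T: "0 \<le> T" using s by simp
  have acf: "unif_abs_cont_on (cball 0 R) {0..T} f"
    using f T R unfolding loewner_solution_def by (simp add: subset_iff)
  then have acf: "unif_abs_cont_on (cball 0 R) {s..T} f"
    by (rule unif_abs_cont_on_subset) (use s in auto)
  have hol: "holomorphic_map_on (\<lambda>z. f z t) (ball 0 1)" if "t \<in> {s..T}" for t
    using f that s by (simp add: loewner_solution_def)
  have "AE t in lebesgue. t \<ge> s \<longrightarrow> (u has_vector_derivative - h (u t) t) (at t)"
    using v z s unfolding transition_mapping_def u_def by auto
  from AE_lebesgue_negligibleE[OF this] obtain N1 where N1: "negligible N1"
    and du: "\<And>t. t \<notin> N1 \<Longrightarrow> t \<ge> s \<Longrightarrow> (u has_vector_derivative - h (u t) t) (at t)" by blast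
  have "AE t in lebesgue. t \<ge> 0 \<longrightarrow> (\<forall>z\<in>ball 0 1. ((\<lambda>\<tau>. f z \<tau>) has_vector_derivative
            frechet_derivative (\<lambda>w. f w t) (at z) (h z t)) (at t))"
    using f by (simp add: loewner_solution_def)
  from AE_lebesgue_negligibleE[OF this] obtain N2 where N2: "negligible N2" and
    df: "\<And>t z. t \<notin> N2 \<Longrightarrow> t \<ge> 0 \<Longrightarrow> z \<in> ball 0 1 \<Longrightarrow> (f z has_vector_derivative
            frechet_derivative (\<lambda>w. f w t) (at z) (h z t)) (at t)" by blast
  obtain B where B: "B \<ge> 0" "\<And>z t. z \<in> cball 0 R \<Longrightarrow> t \<in> {0..T} \<Longrightarrow> norm (f z t) \<le> B"
    using loewner_solution_locally_bounded[OF pb R(2) T] by blast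
  obtain L where L: "L \<ge> 0" "\<And>z x y. z \<in> cball 0 r \<Longrightarrow> 0 \<le> x \<and> x \<le> y \<and> y \<le> T \<Longrightarrow>
      norm (f z y - f z x) \<le> L * (y - x)"
    using loewner_solution_lipschitz_time[OF A h f pb r T] by blast
  have "norm (f (u T) T - f (u s) s) \<le> 0 * (T - s)"
  proof (rule abs_cont_norm_increment_le[where g="\<lambda>_ t. f (u t) t" and z=z, OF _ s(2) negligible_Un[OF N1 N2]])
    show "unif_abs_cont_on {z} {s..T} (\<lambda>_ t. f (u t) t)"
    proof (rule unif_abs_cont_on_dominated[OF acv, of _ _ "B / (R - r) + L"])
      show "0 \<le> B / (R - r) + L" using B L R by simp
      fix x y assume xy: "x \<in> {s..T}" "y \<in> {s..T}" "x \<le> y"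
      have "norm (f (u y) y - f (u x) x) = norm ((f (u y) y - f (u x) y) + (f (u x) y - f (u x) x))" by simp
      also have "\<dots> \<le> norm (f (u y) y - f (u x) y) + norm (f (u x) y - f (u x) x)" by (rule norm_triangle_ineq)
      also have "\<dots> \<le> B / (R - r) * norm (u y - u x) + L * (y - x)"
      proof (intro add_mono L(2))
        show "norm (f (u y) y - f (u x) y) \<le> B / (R - r) * norm (u y - u x)"
          by (rule holomorphic_map_lipschitz[OF hol[OF xy(2)] _ R(1)]) (use R B(2) u xy s in auto)
      qed (use u xy s in auto)
      also have "\<dots> \<le> (B / (R - r) + L) * norm (u y - u x) + (B / (R - r) + L) * (y - x)"
        using B L R xy by (intro add_mono mult_right_mono) auto
      finally show "norm (f (u y) y - f (u x) x) \<le>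
          (B / (R - r) + L) * norm (v z s y - v z s x) + (B / (R - r) + L) * (y - x)"
        by (simp add: u_def)
    qed
    fix t assume t: "t \<in> {s..T} - (N1 \<union> N2)"
    then have tT: "t \<in> {s..T}" and t0: "t \<ge> s" "t \<ge> 0" "t \<notin> N1" "t \<notin> N2" using s by auto
    have ub: "u t \<in> ball 0 1" using u[OF tT] r by simp
    obtain M where M: "((\<lambda>w. f w t) has_derivative (\<lambda>w. M *v w)) (at (u t))"
      using hol[OF tT] ub unfolding holomorphic_map_on_def by blast
    have FM: "frechet_derivative (\<lambda>w. f w t) (at (u t)) = (\<lambda>w. M *v w)"
      using frechet_derivative_at[OF M] by simp
    have du': "(u has_vector_derivative - h (u t) t) (at t within {s..T})"
      using du[OF t0(3,1)] by (rule has_vector_derivative_at_within)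
    have 1: "((\<lambda>\<tau>. f (u \<tau>) t) has_vector_derivative M *v (- h (u t) t)) (at t within {s..T})"
      using vector_derivative_diff_chain_within[OF du' has_derivative_at_withinI[OF M]] by (simp add: o_def)
    have 2: "(f (u t) has_vector_derivative M *v h (u t) t) (at t within {s..T})"
      using df[OF t0(4,2) ub] unfolding FM by (rule has_vector_derivative_at_within)
    have 3: "((\<lambda>\<tau>. f (u \<tau>) \<tau> - f (u \<tau>) t - (f (u t) \<tau> - f (u t) t)) has_vector_derivative 0) (at t within {s..T})"
      by (rule has_vector_derivative_mixed_difference_zero[OF hol acf R u du' tT])
    \<comment> \<open>The summands add up to f (u \<tau>) \<tau>: motion in z alone, motion in t
      alone, and the mixed difference. The first two derivatives cancel and the third is 0.\<close>
    have "((\<lambda>\<tau>. f (u \<tau>) t + (f (u t) \<tau> - f (u t) t) + (f (u \<tau>) \<tau> - f (u \<tau>) t - (f (u t) \<tau> - f (u t) t)))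
        has_vector_derivative M *v (- h (u t) t) + (M *v h (u t) t - 0) + 0) (at t within {s..T})"
      by (intro has_vector_derivative_add has_vector_derivative_diff 1 2 3 has_vector_derivative_const)
    then have "((\<lambda>\<tau>. f (u \<tau>) \<tau>) has_vector_derivative 0) (at t within {s..T})"
      by (simp add: bounded_bilinear.minus_right[OF bounded_bilinear_matrix_vector_mult])
    then show "\<exists>D. ((\<lambda>t. f (u t) t) has_vector_derivative D) (at t within {s..T}) \<and> norm D \<le> 0"
      by (intro exI[of _ 0]) simp
  qed simp
  then have "f (u T) T = f (u s) s" by simp
  then show ?thesis unfolding us unfolding u_def .
qed

section \<open>The truncated expansion\<close>

lemma homogeneous_poly_map_scale:
  assumes "homogeneous_poly_map k P" shows "P (c *s z) = c ^ k *s P z"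
proof -
  obtain a :: "('a \<Rightarrow> nat) \<Rightarrow> complex^'a" where
    P: "\<And>z. P z = (\<Sum>\<alpha> | (\<Sum>j\<in>UNIV. \<alpha> j) = k. (\<Prod>j\<in>UNIV. (z $ j) ^ \<alpha> j) *s a \<alpha>)"
    using assms unfolding homogeneous_poly_map_def by blast
  have "(\<Prod>j\<in>UNIV. ((c *s z) $ j) ^ \<alpha> j) *s a \<alpha> = c ^ k *s ((\<Prod>j\<in>UNIV. (z $ j) ^ \<alpha> j) *s a \<alpha>)"
    if "(\<Sum>j\<in>UNIV. \<alpha> j) = k" for \<alpha>
    using that by (simp add: power_mult_distrib prod.distrib power_sum[symmetric] vector_smult_assoc)
  then show ?thesis unfolding P vec.scale_sum_right by (intro sum.cong) auto
qed

text \<open>Uniqueness of power series identifies a k with the k-th Taylor coefficient of the sum,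
  to which Cauchy's inequality applies.\<close>

lemma power_series_coeff_le:
  fixes a :: "nat \<Rightarrow> complex"
  assumes sums: "\<And>\<zeta>. norm \<zeta> < R \<Longrightarrow> (\<lambda>k. a k * \<zeta> ^ k) sums \<phi> \<zeta>" and r: "0 < r" "r < R"
    and B: "\<And>\<zeta>. norm \<zeta> = r \<Longrightarrow> norm (\<phi> \<zeta>) \<le> B"
  shows "norm (a k) \<le> B / r ^ k"
proof -
  have hol: "\<phi> holomorphic_on ball 0 R"
    by (rule power_series_holomorphic[where a = a]) (use sums in simp)
  have "\<forall>\<^sub>F \<zeta> in nhds (0::complex). \<zeta> \<in> ball 0 R"
    using r by (intro eventually_nhds_in_open) auto
  then have "\<phi> has_fps_expansion Abs_fps a"
    by (intro has_fps_expansionI) (auto elim!: eventually_mono simp: sums)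
  then have "norm (a k) = norm ((deriv ^^ k) \<phi> 0) / fact k"
    using fps_nth_fps_expansion[of \<phi> "Abs_fps a" k] by (simp add: norm_divide)
  moreover have "norm ((deriv ^^ k) \<phi> 0) \<le> fact k * B / r ^ k"
  proof (rule Cauchy_inequality)
    show "\<phi> holomorphic_on ball 0 r" using hol r by (auto intro: holomorphic_on_subset)
    show "continuous_on (cball 0 r) \<phi>"
      by (rule holomorphic_on_imp_continuous_on[OF holomorphic_on_subset[OF hol]]) (use r in auto)
  qed (use r B in auto)
  ultimately show ?thesis by (simp add: pos_divide_le_eq mult.commute)
qed

text \<open>On the line through a unit vector u the vectors P k u are Taylor coefficients, and
  Cauchy's inequality at radius 1/2 gives |P k u| <= S 2^k. For |w| <= 1/4 the tail is dominated by
  a geometric series of ratio 1/2, whence the factor 2.\<close>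

lemma homogeneous_expansion_tail_le:
  fixes P :: "nat \<Rightarrow> complex^'n \<Rightarrow> complex^'n"
  assumes hom: "\<And>k c z. P k (c *s z) = c ^ k *s P k z"
    and sums: "\<And>z. norm z < 1 \<Longrightarrow> (\<lambda>k. P k z) sums g z"
    and S: "\<And>z. norm z \<le> 1 / 2 \<Longrightarrow> norm (g z) \<le> S" and w: "norm w \<le> 1 / 4"
  shows "norm (g w - (\<Sum>k<N. P k w)) \<le> 2 * S * (2 * norm w) ^ N"
proof -
  have S0: "S \<ge> 0" using order_trans[OF norm_ge_zero S[of 0]] by simp
  have coeff: "norm (P k u) \<le> S * 2 ^ k" if u: "norm u = 1" for k u
  proof (cases "P k u = 0")
    case True then show ?thesis using S0 by simp
  next
    case False
    define e where "e = P k u"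
    have "norm (cinner (P k u) e) \<le> (S * norm e) / (1 / 2) ^ k"
    proof (rule power_series_coeff_le[where R = 1])
      fix \<zeta> :: complex assume "norm \<zeta> < 1"
      then have "(\<lambda>k. P k (\<zeta> *s u)) sums g (\<zeta> *s u)"
        using u by (intro sums) (simp add: norm_vector_scale)
      from bounded_linear.sums[OF bounded_linear_cinner_left this, of e]
      show "(\<lambda>k. cinner (P k u) e * \<zeta> ^ k) sums cinner (g (\<zeta> *s u)) e"
        by (simp add: hom cinner_scale_left mult.commute)
    next
      fix \<zeta> :: complex assume "norm \<zeta> = 1 / 2"
      then have "norm (g (\<zeta> *s u)) \<le> S" using u by (intro S) (simp add: norm_vector_scale)
      then show "norm (cinner (g (\<zeta> *s u)) e) \<le> S * norm e"
        by (intro order_trans[OF norm_cinner_le] mult_right_mono) auto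
    qed auto
    then have "norm e * norm e \<le> (S * 2 ^ k) * norm e"
      by (simp add: e_def cinner_self norm_mult power2_eq_square power_one_over mult_ac)
    then have "norm e \<le> S * 2 ^ k" by (rule mult_right_le_imp_le) (simp add: e_def False)
    then show ?thesis by (simp add: e_def)
  qed
  have bound: "norm (P k w) \<le> S * (2 * norm w) ^ k" for k
  proof (cases "w = 0")
    case True
    \<comment> \<open>Here 0 ^ 0 = 1 matters: in degree 0 homogeneity makes P constant, so its value
      at 0 is its value at a unit vector.\<close>
    have "norm (P k 0) \<le> S * 0 ^ k"
    proof (cases k)
      case 0
      define u :: "complex^'n" where "u = axis undefined 1"
      have "P 0 0 = P 0 u" using hom[of 0 0 u] by simp
      then show ?thesis using coeff[of u 0] 0 by (simp add: u_def norm_axis_1)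
    next
      case (Suc k')
      then show ?thesis using hom[of k 0 0] by simp
    qed
    then show ?thesis using True by simp
  next
    case False
    define u where "u = (1 / norm w) *\<^sub>R w"
    have u: "norm u = 1" using False by (simp add: u_def)
    have "w = of_real (norm w) *s u" using False by (simp add: u_def of_real_vector_scale)
    then have "P k w = of_real (norm w) ^ k *s P k u" by (metis hom)
    then have "norm (P k w) = norm w ^ k * norm (P k u)" by (simp add: norm_vector_scale norm_power)
    also have "\<dots> \<le> norm w ^ k * (S * 2 ^ k)" using coeff[OF u] by (intro mult_left_mono) auto
    finally show ?thesis by (simp add: power_mult_distrib mult_ac)
  qed
  have q: "2 * norm w \<le> 1 / 2" using w by simp
  have "(\<lambda>k. P (k + N) w) sums (g w - (\<Sum>k<N. P k w))"
    by (rule sums_iff_shift[where f = "\<lambda>k. P k w", THEN iffD2]) (use sums[of w] w in simp)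
  then have "g w - (\<Sum>k<N. P k w) = (\<Sum>k. P (k + N) w)" by (simp add: sums_iff)
  moreover have "norm (\<Sum>k. P (k + N) w) \<le> (\<Sum>k. S * (2 * norm w) ^ N * (1 / 2) ^ k)"
  proof (rule norm_suminf_le)
    show "summable (\<lambda>k. S * (2 * norm w) ^ N * (1 / 2) ^ k :: real)"
      by (intro summable_mult summable_geometric) simp
    fix k
    have "norm (P (k + N) w) \<le> S * (2 * norm w) ^ (k + N)" by (rule bound)
    also have "\<dots> = S * (2 * norm w) ^ N * (2 * norm w) ^ k" by (simp add: power_add mult_ac)
    also have "\<dots> \<le> S * (2 * norm w) ^ N * (1 / 2) ^ k"
      using q S0 by (intro mult_left_mono power_mono) auto
    finally show "norm (P (k + N) w) \<le> S * (2 * norm w) ^ N * (1 / 2) ^ k" .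
  qed
  moreover have "(\<Sum>k. S * (2 * norm w) ^ N * (1 / 2) ^ k :: real) = S * (2 * norm w) ^ N * 2"
    using suminf_mult[OF summable_geometric[of "1 / 2 :: real"], of "S * (2 * norm w) ^ N"]
      suminf_geometric[of "1 / 2 :: real"] by simp
  ultimately show ?thesis by (simp add: mult_ac)
qed

lemma tendsto_poly_times_exp:
  fixes P :: "real poly"
  assumes a: "a > 0"
  shows "((\<lambda>t. poly P t * exp (- a * t)) \<longlongrightarrow> 0) at_top"
proof -
  have "((\<lambda>t. t ^ i * exp (- a * t)) \<longlongrightarrow> 0) at_top" for i
  proof -
    have "filterlim (\<lambda>t. a * t) at_top at_top"
      by (rule filterlim_tendsto_pos_mult_at_top[OF tendsto_const a filterlim_ident])
    then have "((\<lambda>t. (1 / a ^ i) * ((a * t) ^ i / exp (a * t))) \<longlongrightarrow> (1 / a ^ i) * 0) at_top"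
      by (intro tendsto_intros filterlim_compose[OF tendsto_power_div_exp_0])
    moreover have "(1 / a ^ i) * ((a * t) ^ i / exp (a * t)) = t ^ i * exp (- a * t)" for t
      using a by (simp add: power_mult_distrib exp_minus field_simps)
    ultimately show ?thesis by simp
  qed
  then have "((\<lambda>t. \<Sum>i\<le>degree P. coeff P i * (t ^ i * exp (- a * t))) \<longlongrightarrow> (\<Sum>i\<le>degree P. coeff P i * 0)) at_top"
    by (intro tendsto_sum tendsto_mult_left)
  then show ?thesis by (simp add: poly_altdef sum_distrib_right mult.assoc)
qed

lemma compact_subset_unit_ball:
  fixes K :: "'a::real_normed_vector set"
  assumes "compact K" "K \<subseteq> ball 0 1"
  shows "\<exists>r. 0 \<le> r \<and> r < 1 \<and> K \<subseteq> cball 0 r"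
proof (cases "K = {}")
  case True
  then show ?thesis by (intro exI[of _ 0]) simp
next
  case False
  have "continuous_on K norm" by (intro continuous_intros)
  then obtain x where x: "x \<in> K" "\<forall>y\<in>K. norm y \<le> norm x"
    using continuous_attains_sup[OF assms(1) False] by blast
  then show ?thesis using assms(2) by (intro exI[of _ "norm x"]) (auto simp: subset_iff)
qed

theorem proposition2p1:
  fixes A :: "complex^'n^'n"
    and h f :: "complex^'n \<Rightarrow> real \<Rightarrow> complex^'n"
    and v :: "complex^'n \<Rightarrow> real \<Rightarrow> real \<Rightarrow> complex^'n"
    and F :: "nat \<Rightarrow> complex^'n \<Rightarrow> real \<Rightarrow> complex^'n"
    and n0 :: nat
  assumes "m_lower A > 0"
    and "n0 = nat \<lfloor>k_plus A / m_lower A\<rfloor>"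
    and "h \<in> class_H A"
    and "transition_mapping h v"
    and "loewner_solution A h f"
    and "polynomially_bounded A f"
    and "\<forall>k\<ge>2. \<forall>t\<ge>0. homogeneous_poly_map k (\<lambda>z. F k z t)"
    and "\<forall>z\<in>ball 0 1. \<forall>t\<ge>0. summable (\<lambda>k. F (k + 2) z t) \<and>
           f z t = mexp (t *\<^sub>R A) *v (z + (\<Sum>k. F (k + 2) z t))"
  shows "\<forall>s\<ge>0.
      (\<forall>z\<in>ball 0 1.
         ((\<lambda>t. mexp (t *\<^sub>R A) *v (v z s t + (\<Sum>k=2..n0. F k (v z s t) t))) \<longlongrightarrow> f z s) at_top) \<and>
      (\<forall>K. compact K \<and> K \<subseteq> ball 0 1 \<longrightarrow>
         uniform_limit K
           (\<lambda>t z. mexp (t *\<^sub>R A) *v (v z s t + (\<Sum>k=2..n0. F k (v z s t) t)))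
           (\<lambda>z. f z s) at_top)"
proof -
  define m where "m = m_lower A"
  have m: "m > 0" using assms(1) by (simp add: m_def)
  \<comment> \<open>The first omitted degree. Degrees 0 and 1 are always kept by the truncation,
    hence the maximum with 2; for n0 < 2 the sum over {2..n0} is empty.\<close>
  define N where "N = max (n0 + 1) 2"
  have "k_plus A / m < real n0 + 1"
    unfolding assms(2) m_def by linarith
  also have "\<dots> \<le> N" by (simp add: N_def)
  finally have "k_plus A < N * m" using m by (simp add: pos_divide_less_eq)
  \<comment> \<open>\<kappa> must exceed k_+(A) strictly for the growth bound, and what remains up
    to N m is the exponent \<open>a\<close> that beats the polynomial \<open>Q\<close>.\<close>
  then obtain \<kappa> where \<kappa>: "\<kappa> > k_plus A" "\<kappa> < N * m" using dense by blast
  define a where "a = N * m - \<kappa>"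
  have a: "a > 0" using \<kappa>(2) by (simp add: a_def)
  obtain C where C: "C \<ge> 0" "\<And>t x. t \<ge> 0 \<Longrightarrow> norm (mexp (t *\<^sub>R A) *v x) \<le> C * exp (\<kappa> * t) * norm x"
    using norm_mexp_mult_le[OF \<kappa>(1)] by blast
  have "compact (cball 0 (1/2) :: (complex^'n) set)" "cball 0 (1/2) \<subseteq> (ball 0 1 :: (complex^'n) set)"
    by auto
  then obtain c Q where cQ: "\<And>z t. z \<in> cball 0 (1/2) \<Longrightarrow> t \<ge> 0 \<Longrightarrow>
      norm (mexp ((- t) *\<^sub>R A) *v f z t) \<le> c * poly Q t"
    using assms(6) unfolding polynomially_bounded_def by meson
  have tail: "norm (mexp (t *\<^sub>R A) *v (w + (\<Sum>k=2..n0. F k w t)) - f w t) \<le>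
      C * exp (\<kappa> * t) * (2 * (c * poly Q t) * (2 * norm w) ^ N)"
    if t: "t \<ge> 0" and w: "norm w \<le> 1 / 4" for t w
  proof -
    \<comment> \<open>Padding with 0 in degree 0 and the identity in degree 1 turns e^{-tA} f(.,t)
      into a full homogeneous series.\<close>
    define P where "P k z = (if k = 0 then 0 else if k = 1 then z else F k z t)" for k z
    define g where "g z = mexp ((- t) *\<^sub>R A) *v f z t" for z
    have g: "g z = z + (\<Sum>k. F (k + 2) z t)" if "norm z < 1" for z
      using assms(8) that t mexp_uminus_mult[of t A] by (simp add: g_def)
    have "P k (b *s z) = b ^ k *s P k z" for k b z
    proof -
      consider "k = 0" | "k = 1" | "k \<ge> 2" by linarith
      then show ?thesis
      proof cases
        case 3
        then show ?thesis
          using homogeneous_poly_map_scale[of k "\<lambda>z. F k z t"] assms(7) t by (simp add: P_def)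
      qed (simp_all add: P_def)
    qed
    moreover have "(\<lambda>k. P k z) sums g z" if z: "norm z < 1" for z
    proof -
      have "(\<lambda>k. F (k + 2) z t) sums (\<Sum>k. F (k + 2) z t)"
        using assms(8) z t by (intro summable_sums) simp
      then have "(\<lambda>k. P (k + 2) z) sums (\<Sum>k. F (k + 2) z t)" by (simp add: P_def)
      then have "(\<lambda>k. P k z) sums ((\<Sum>k. F (k + 2) z t) + (\<Sum>k<2. P k z))"
        by (rule sums_iff_shift[where f = "\<lambda>k. P k z", THEN iffD1])
      then show ?thesis by (simp add: g[OF z] P_def numeral_2_eq_2 add.commute)
    qed
    moreover have "norm (g z) \<le> c * poly Q t" if "norm z \<le> 1 / 2" for z
      using cQ[of z t] that t by (simp add: g_def)
    ultimately have "norm (g w - (\<Sum>k<N. P k w)) \<le> 2 * (c * poly Q t) * (2 * norm w) ^ N"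
      using w by (rule homogeneous_expansion_tail_le)
    moreover have "(\<Sum>k<N. P k w) = w + (\<Sum>k=2..n0. F k w t)"
    proof -
      have "{..<N} = {0, 1} \<union> {2..n0}" by (auto simp: N_def)
      then have "(\<Sum>k<N. P k w) = (\<Sum>k\<in>{0, 1}. P k w) + (\<Sum>k=2..n0. P k w)"
        by (simp only:) (rule sum.union_disjoint, auto)
      also have "(\<Sum>k=2..n0. P k w) = (\<Sum>k=2..n0. F k w t)" by (intro sum.cong) (auto simp: P_def)
      finally show ?thesis by (simp add: P_def)
    qed
    moreover have "f w t = mexp (t *\<^sub>R A) *v g w"
      using mexp_uminus_mult[of "- t" A] by (simp add: g_def)
    ultimately have le: "norm (w + (\<Sum>k=2..n0. F k w t) - g w) \<le> 2 * (c * poly Q t) * (2 * norm w) ^ N"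
      and eq: "mexp (t *\<^sub>R A) *v (w + (\<Sum>k=2..n0. F k w t)) - f w t =
        mexp (t *\<^sub>R A) *v (w + (\<Sum>k=2..n0. F k w t) - g w)"
      by (simp_all add: norm_minus_commute matrix_vector_mult_diff_distrib)
    show ?thesis unfolding eq
      using C(1) by (intro order_trans[OF C(2)[OF t]] mult_left_mono le) auto
  qed
  have unif: "uniform_limit K (\<lambda>t z. mexp (t *\<^sub>R A) *v (v z s t + (\<Sum>k=2..n0. F k (v z s t) t)))
      (\<lambda>z. f z s) at_top" if s: "s \<ge> 0" and K: "compact K" "K \<subseteq> ball 0 1" for s K
  proof (rule uniform_limitI)
    fix e :: real assume e: "e > 0"
    obtain r where r: "0 \<le> r" "r < 1" and Kr: "K \<subseteq> cball 0 r"
      using compact_subset_unit_ball[OF K] by blast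
    \<comment> \<open>The factor exp (m s) converts decay in t - s into decay in t.\<close>
    define D where "D = exp (2 * (1 + r) / (1 - r)) * exp (m * s)"
    have D: "D > 0" by (simp add: D_def)
    have decay: "norm (v z s t) \<le> D * exp (- m * t)" if "z \<in> K" "s \<le> t" for z t
    proof -
      have "norm (v z s t) \<le> exp (2 * (1 + r) / (1 - r)) * exp (- m * (t - s))"
        unfolding m_def using that Kr s
        by (intro transition_exponential_decay[OF assms(1,3,4) r]) auto
      also have "\<dots> = D * exp (- m * t)" by (simp add: D_def exp_add[symmetric] algebra_simps)
      finally show ?thesis .
    qed
    define \<beta> where "\<beta> t = C * 2 * c * (2 * D) ^ N * (poly Q t * exp (- a * t))" for t
    have "(\<beta> \<longlongrightarrow> C * 2 * c * (2 * D) ^ N * 0) at_top"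
      unfolding \<beta>_def by (intro tendsto_mult_left tendsto_poly_times_exp a)
    then have "\<forall>\<^sub>F t in at_top. \<beta> t < e" using e by (simp add: order_tendstoD)
    \<comment> \<open>The constant polynomial 1 gives plain exponential decay: eventually all of K
      is carried into the ball of radius 1/4, where the truncation estimate is valid.\<close>
    moreover have "((\<lambda>t. D * (poly 1 t * exp (- m * t))) \<longlongrightarrow> D * 0) at_top"
      by (intro tendsto_mult_left tendsto_poly_times_exp m)
    then have "\<forall>\<^sub>F t in at_top. D * (poly 1 t * exp (- m * t)) < 1 / 4" by (rule order_tendstoD) simp
    moreover have "\<forall>\<^sub>F t in at_top. s \<le> t" by (rule eventually_ge_at_top)
    ultimately show "\<forall>\<^sub>F t in at_top. \<forall>z\<in>K. dist (mexp (t *\<^sub>R A) *v (v z s t + (\<Sum>k=2..n0. F k (v z s t) t))) (f z s) < e"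
    proof eventually_elim
      case (elim t)
      show ?case
      proof
        fix z assume z: "z \<in> K"
        define w where "w = v z s t"
        have t: "t \<ge> 0" using elim s by simp
        have w: "norm w \<le> D * exp (- m * t)" using decay[OF z] elim by (simp add: w_def)
        have cQ0: "0 \<le> c * poly Q t" using order_trans[OF norm_ge_zero cQ[of 0 t]] t by simp
        have "norm (mexp (t *\<^sub>R A) *v (w + (\<Sum>k=2..n0. F k w t)) - f w t) \<le>
            C * exp (\<kappa> * t) * (2 * (c * poly Q t) * (2 * norm w) ^ N)"
          using w elim by (intro tail[OF t]) simp
        also have "\<dots> \<le> C * exp (\<kappa> * t) * (2 * (c * poly Q t) * (2 * (D * exp (- m * t))) ^ N)"
          using C(1) cQ0 w by (intro mult_left_mono power_mono) auto
        also have "\<dots> = C * 2 * c * (2 * D) ^ N * (poly Q t * (exp (\<kappa> * t) * exp (- m * t) ^ N))"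
          by (simp add: power_mult_distrib mult_ac)
        also have "exp (\<kappa> * t) * exp (- m * t) ^ N = exp (- a * t)"
          by (simp add: a_def exp_of_nat_mult[symmetric] exp_add[symmetric] algebra_simps)
        also have "C * 2 * c * (2 * D) ^ N * (poly Q t * exp (- a * t)) < e"
          using elim by (simp add: \<beta>_def)
        finally have "norm (mexp (t *\<^sub>R A) *v (w + (\<Sum>k=2..n0. F k w t)) - f w t) < e" .
        moreover have "f w t = f z s"
          unfolding w_def using z K s elim
          by (intro loewner_solution_transition[OF assms(1,3,4,5,6)]) auto
        ultimately show "dist (mexp (t *\<^sub>R A) *v (v z s t + (\<Sum>k=2..n0. F k (v z s t) t))) (f z s) < e"
          by (simp add: dist_norm w_def)
      qed
    qed
  qed
  show ?thesis
  proof (intro allI impI conjI ballI)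
    fix s :: real and z :: "complex^'n" assume s: "s \<ge> 0" and z: "z \<in> ball 0 1"
    show "((\<lambda>t. mexp (t *\<^sub>R A) *v (v z s t + (\<Sum>k=2..n0. F k (v z s t) t))) \<longlongrightarrow> f z s) at_top"
      using tendsto_uniform_limitI[OF unif[OF s, of "{z}"], of z] z by simp
  qed (use unif in auto)
qed

end
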